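(* Let $u^\star\in\mathbb R^d$ be a unit vector, $m\ge1$, $\mathsf L>0$, $\mathcal F^{\rm sp}_{\rm link}\subset(\mathcal F^{\mathsf L}_{\rm link})^m$, and $\vec\sigma^\star=(\sigma^\star_1,\dots,\sigma^\star_m)\in\mathcal F^{\rm sp}_{\rm link}$. Let $X_1,X_2,\dots$ be i.i.d. random vectors in $\mathbb R^d$ with $\mathbb E[\|X\|_2^k]<\infty$, where $k\ge2$, and let labels $Y_{ij}\in\{-1,1\}$, $j\le m$, be conditionally independent given $X_i$ with $\mathbb P(Y_{ij}=y\mid X_i=x)=\sigma_j^\star(y\langle u^\star,x\rangle)$. Let $u_n^{\rm init}$ be an initial estimate of $u^\star$, independent of $(X_i,Y_{ij})_{i\le n,j\le m}$, and let $\epsilon_n$ be (potentially random) with $\|u_n^{\rm init}-u^\star\|_2\le\epsilon_n$ for all $n$. Set $$\vec\sigma_n=\operatorname*{argmin}_{\vec\sigma\in\mathcal F^{\rm sp}_{\rm link}}\sum_{i=1}^n\sum_{j=1}^m\Big(\sigma_j(\langle u_n^{\rm init},X_i\rangle)-\mathbf 1\{Y_{ij}=1\}\Big)^2.$$ Then with probability $1$ there is a finite (random) $C<\infty$ such that for all large enough $n$, $$\big\|\vec\sigma_n(Y\langle u^\star,X\rangle)-\vec\sigma^\star(Y\langle u^\star,X\rangle)\big\|_{L^2(\mathbb P)}^2\le C\Big[n^{\frac2{3k}-\frac23}+\epsilon_n^2+\mathsf L\,n^{-\frac k{2(k+1)}}\Big].$$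
   Context: $\mathcal F^{\mathsf L}_{\rm link}$ is the set of nondecreasing, $\mathsf L$-Lipschitz $\sigma:\mathbb R\to[0,1]$ with $\sigma\not\equiv\frac12$, $\sigma(t)+\sigma(-t)=1$ for all $t$, $\sigma(0)=\frac12$ and $\mathrm{sign}(\sigma(t)-\frac12)=\mathrm{sign}(t)$. The norm is $\|\vec\sigma(Y\langle u^\star,X\rangle)-\vec g(Y\langle u^\star,X\rangle)\|_{L^2(\mathbb P)}^2=\mathbb E\sum_{j=1}^m(\sigma_j(Y_j\langle u^\star,X\rangle)-g_j(Y_j\langle u^\star,X\rangle))^2$, where the expectation is over a fresh copy $(X,Y_1,\dots,Y_m)$ of the data with $\vec\sigma,\vec g$ held fixed. It is assumed that the minimizer $\vec\sigma_n$ exists (any choice of minimizer may be used). *)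

theory Defs
  imports "HOL-Probability.Probability"
begin

definition link_class :: "real \<Rightarrow> (real \<Rightarrow> real) set" where
  "link_class L = {\<sigma>. mono \<sigma> \<and> L-lipschitz_on UNIV \<sigma> \<and> range \<sigma> \<subseteq> {0..1}
     \<and> (\<exists>t. \<sigma> t \<noteq> 1/2) \<and> (\<forall>t. \<sigma> t + \<sigma> (- t) = 1) \<and> \<sigma> 0 = 1/2
     \<and> (\<forall>t. sgn (\<sigma> t - 1/2) = sgn t)}"

text \<open>
  Conditional independence of the family \<open>(Z i)\<close>, \<open>i \<in> I\<close>, given the sub-sigma-algebra \<open>F\<close>:
  conditional probabilities of finite intersections factorise almost surely.
\<close>
definition cond_indep_vars ::
    "'a measure \<Rightarrow> 'a measure \<Rightarrow> ('i \<Rightarrow> 'b measure) \<Rightarrow> ('i \<Rightarrow> 'a \<Rightarrow> 'b) \<Rightarrow> 'i set \<Rightarrow> bool" where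
  "cond_indep_vars M F N Z I \<longleftrightarrow>
     (\<forall>K \<subseteq> I. finite K \<longrightarrow> (\<forall>A \<in> (\<Pi> i\<in>K. sets (N i)).
        AE w in M. real_cond_exp M F (\<lambda>v. \<Prod>i\<in>K. indicat_real (A i) (Z i v)) w
          = (\<Prod>i\<in>K. real_cond_exp M F (\<lambda>v. indicat_real (A i) (Z i v)) w)))"

abbreviation sigma_gen :: "'a measure \<Rightarrow> 'b measure \<Rightarrow> ('a \<Rightarrow> 'b) \<Rightarrow> 'a measure" where
  "sigma_gen M N Z \<equiv> vimage_algebra (space M) Z N"

text \<open>
  Independence of two random variables with values in different types (the library's
  \<open>indep_var\<close> needs a common type).
\<close>
definition indep_rvs ::
    "'a measure \<Rightarrow> 'b measure \<Rightarrow> ('a \<Rightarrow> 'b) \<Rightarrow> 'c measure \<Rightarrow> ('a \<Rightarrow> 'c) \<Rightarrow> bool" where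
  "indep_rvs M N Z N' Z' \<longleftrightarrow> Z \<in> measurable M N \<and> Z' \<in> measurable M N'
     \<and> prob_space.indep_set M (sets (sigma_gen M N Z)) (sets (sigma_gen M N' Z'))"

abbreviation label_space :: "real measure" where
  "label_space \<equiv> count_space {-1, 1}"

abbreviation obs_space :: "nat \<Rightarrow> ((real^'d) \<times> (nat \<Rightarrow> real)) measure" where
  "obs_space m \<equiv> borel \<Otimes>\<^sub>M (\<Pi>\<^sub>M j\<in>{1..m}. label_space)"

definition obs :: "nat \<Rightarrow> (nat \<Rightarrow> 'w \<Rightarrow> real^'d) \<Rightarrow> (nat \<Rightarrow> nat \<Rightarrow> 'w \<Rightarrow> real)
    \<Rightarrow> nat \<Rightarrow> 'w \<Rightarrow> (real^'d) \<times> (nat \<Rightarrow> real)" where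
  "obs m X Y i w = (X i w, \<lambda>j\<in>{1..m}. Y i j w)"

definition emp_loss :: "nat \<Rightarrow> nat \<Rightarrow> real^'d \<Rightarrow> (nat \<Rightarrow> real^'d) \<Rightarrow> (nat \<Rightarrow> nat \<Rightarrow> real)
    \<Rightarrow> (nat \<Rightarrow> real \<Rightarrow> real) \<Rightarrow> real" where
  "emp_loss n m u x y \<sigma> =
     (\<Sum>i=1..n. \<Sum>j=1..m. (\<sigma> j (u \<bullet> x i) - indicat_real {1} (y i j))\<^sup>2)"

text \<open>
  The squared \<open>L\<^sup>2\<close> distance; \<open>P\<close> is the law of one observation, so integrating
  against it is taking the expectation over a fresh copy with \<open>\<sigma>\<close> and \<open>g\<close> held fixed.
\<close>
definition link_L2_sq :: "((real^'d) \<times> (nat \<Rightarrow> real)) measure \<Rightarrow> nat \<Rightarrow> real^'d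
    \<Rightarrow> (nat \<Rightarrow> real \<Rightarrow> real) \<Rightarrow> (nat \<Rightarrow> real \<Rightarrow> real) \<Rightarrow> real" where
  "link_L2_sq P m u \<sigma> g =
     (\<integral>(x, y). (\<Sum>j=1..m. (\<sigma> j (y j * (u \<bullet> x)) - g j (y j * (u \<bullet> x)))\<^sup>2) \<partial>P)"

end

theory Submission
  imports Defs "HOL-Real_Asymp.Real_Asymp"
begin

text \<open>
  Since \<open>k \<ge> 2\<close>, the slower of the two deterministic rates is \<open>n\<close> to the power \<open>-k / (2 (k + 1))\<close>, whose exponent is
  strictly larger than \<open>-1/2\<close>. As \<open>C\<close> may depend on \<open>L\<close>, \<open>k\<close> and \<open>m\<close>, it is therefore enough to control the
  empirical process uniformly at a polynomially slower scale than \<open>1 / sqrt n\<close>, without localisation.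
  A monotone link is, up to \<open>L / n\<close> and up to tails beyond \<open>n\<close>, a subconvex combination of
  \<open>2 n\<^sup>2 + 1\<close> half-line indicators, so Hoeffding's inequality with a union bound controls all links at once.
  The initial estimate is independent of the sample, so it may be frozen by Fubini's theorem, and the
  Borel-Cantelli lemma gives almost sure bounds. The basic inequality for the least squares minimiser and
  the Lipschitz property, at cost \<open>L\<^sup>2 \<epsilon>\<^sup>2 E \<bar>X\<bar>\<^sup>2\<close>, then yield the claim; for \<open>\<epsilon> \<ge> 1\<close> the bound is trivial.
\<close>

section \<open>Concentration, freezing of an independent parameter, almost sure uniform
  deviations\<close>

text \<open>Hoeffding's inequality for the variables \<open>f (Z i)\<close>, whose ranges have
  length 1, with the sum rescaled to a mean.\<close>

lemma (in prob_space) prob_mean_deviation_le: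
  fixes f :: "'b \<Rightarrow> real"
  assumes indep: "indep_vars (\<lambda>_. N) Z {1..n}"
    and f: "f \<in> borel_measurable N" "\<And>z. f z \<in> {0..1}"
    and c: "\<And>i. i \<in> {1..n} \<Longrightarrow> expectation (\<lambda>w. f (Z i w)) = c"
    and n: "n \<ge> 1" and r: "r \<ge> 0"
  shows "prob {w \<in> space M. r \<le> \<bar>(\<Sum>i=1..n. f (Z i w)) / real n - c\<bar>} \<le> 2 * exp (- 2 * real n * r\<^sup>2)"
proof -
  have ind: "indep_vars (\<lambda>_. borel) (\<lambda>i w. f (Z i w)) {1..n}"
    using indep_vars_compose2[OF indep, of "\<lambda>_. f" "\<lambda>_. borel"] f(1) by auto
  interpret H: Hoeffding_ineq M "{1..n}" "\<lambda>i w. f (Z i w)" "\<lambda>_. 0" "\<lambda>_. 1" "real n * c"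
    by unfold_locales (use ind f(2) c in auto)
  have eq: "real n * r \<le> \<bar>S - real n * c\<bar> \<longleftrightarrow> r \<le> \<bar>S / real n - c\<bar>" for S
  proof -
    have "S - real n * c = real n * (S / real n - c)"
      using n by (simp add: field_simps)
    then show ?thesis using n by (simp add: abs_mult)
  qed
  have "prob {w \<in> space M. real n * r \<le> \<bar>(\<Sum>i\<in>{1..n}. f (Z i w)) - real n * c\<bar>}
      \<le> 2 * exp (- 2 * (real n * r)\<^sup>2 / (\<Sum>i\<in>{1..n}. (1 - 0)\<^sup>2))"
    by (rule H.Hoeffding_ineq_abs_ge) (use n r in auto)
  also have "- 2 * (real n * r)\<^sup>2 / (\<Sum>i\<in>{1..n}. (1 - 0)\<^sup>2) = - 2 * real n * r\<^sup>2"
    using n by (simp add: power2_eq_square)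
  finally show ?thesis by (simp only: eq)
qed

text \<open>Measurable rectangles generate the product sigma-algebra, and on a rectangle the claim
  is exactly the independence of the two generated sigma-algebras.\<close>

lemma (in prob_space) distr_pair_indep_rvs:
  assumes "indep_rvs M N U N' V"
  shows "distr M N U \<Otimes>\<^sub>M distr M N' V = distr M (N \<Otimes>\<^sub>M N') (\<lambda>w. (U w, V w))"
proof -
  have [measurable]: "U \<in> measurable M N" "V \<in> measurable M N'"
    and ind: "indep_set (sets (sigma_gen M N U)) (sets (sigma_gen M N' V))"
    using assms by (auto simp: indep_rvs_def)
  interpret U: prob_space "distr M N U" by (rule prob_space_distr) simp
  interpret V: prob_space "distr M N' V" by (rule prob_space_distr) simp
  show ?thesis
  proof (rule pair_measure_eqI)
    fix A B assume "A \<in> sets (distr M N U)" "B \<in> sets (distr M N' V)"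
    then have [measurable]: "A \<in> sets N" "B \<in> sets N'" by auto
    have "prob ((U -` A \<inter> space M) \<inter> (V -` B \<inter> space M))
        = prob (U -` A \<inter> space M) * prob (V -` B \<inter> space M)"
      by (intro indep_setD[OF ind] in_vimage_algebra) simp_all
    moreover have "(\<lambda>w. (U w, V w)) -` (A \<times> B) \<inter> space M = (U -` A \<inter> space M) \<inter> (V -` B \<inter> space M)"
      by auto
    ultimately show "emeasure (distr M N U) A * emeasure (distr M N' V) B
        = emeasure (distr M (N \<Otimes>\<^sub>M N') (\<lambda>w. (U w, V w))) (A \<times> B)"
      by (simp add: emeasure_distr emeasure_eq_measure ennreal_mult)
  qed (auto simp: U.sigma_finite_measure_axioms V.sigma_finite_measure_axioms cong: sets_pair_measure_cong)
qed

text \<open>The joint law is a product, so the probability is the average over \<open>u\<close> of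
  the probabilities of the sections at \<open>u\<close>. A bound that holds for every frozen
  \<open>u\<close> therefore survives substituting the random \<open>U\<close>.\<close>

lemma (in prob_space) prob_indep_rvs_le:
  assumes ind: "indep_rvs M N U N' V" and A[measurable]: "A \<in> sets (N \<Otimes>\<^sub>M N')"
    and p: "\<And>u. u \<in> space N \<Longrightarrow> prob {w \<in> space M. (u, V w) \<in> A} \<le> p" and "p \<ge> 0"
  shows "prob {w \<in> space M. (U w, V w) \<in> A} \<le> p"
proof -
  have [measurable]: "U \<in> measurable M N" "V \<in> measurable M N'"
    using ind by (auto simp: indep_rvs_def)
  interpret U: prob_space "distr M N U" by (rule prob_space_distr) simp
  interpret V: prob_space "distr M N' V" by (rule prob_space_distr) simp
  have "ennreal (prob {w \<in> space M. (U w, V w) \<in> A})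
      = emeasure (distr M (N \<Otimes>\<^sub>M N') (\<lambda>w. (U w, V w))) A"
    by (auto simp: emeasure_distr emeasure_eq_measure intro!: arg_cong[where f = prob])
  also have "\<dots> = (\<integral>\<^sup>+u. emeasure (distr M N' V) (Pair u -` A) \<partial>distr M N U)"
    unfolding distr_pair_indep_rvs[OF ind, symmetric]
    by (rule V.emeasure_pair_measure_alt) simp
  also have "\<dots> \<le> (\<integral>\<^sup>+u. ennreal p \<partial>distr M N U)"
  proof (rule nn_integral_mono)
    fix u assume "u \<in> space (distr M N U)"
    then have u: "u \<in> space N" by simp
    have "emeasure (distr M N' V) (Pair u -` A) = prob (V -` (Pair u -` A) \<inter> space M)"
      by (subst emeasure_distr) (auto simp: emeasure_eq_measure sets_Pair1)
    also have "V -` (Pair u -` A) \<inter> space M = {w \<in> space M. (u, V w) \<in> A}" by auto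
    finally show "emeasure (distr M N' V) (Pair u -` A) \<le> ennreal p"
      using p[OF u] by (simp add: ennreal_leI)
  qed
  also have "\<dots> = ennreal p" using U.emeasure_space_1 by simp
  finally show ?thesis using \<open>p \<ge> 0\<close> by simp
qed

text \<open>With \<open>u\<close> frozen, Hoeffding's inequality for each index and a union bound
  over \<open>I n\<close> give the \<open>n\<close>-th summand of \<open>summ\<close>. Independence
  of \<open>U n\<close> from the sample transfers this bound to the random parameter, and the
  Borel-Cantelli lemma concludes.\<close>

lemma (in prob_space) uniform_deviation_AE:
  fixes \<phi> :: "nat \<Rightarrow> 'i \<Rightarrow> 'u \<Rightarrow> 'z \<Rightarrow> real"
  assumes indep: "indep_vars (\<lambda>_. N) Z {1..}"
    and U: "\<And>n. n \<ge> 1 \<Longrightarrow>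
      indep_rvs M B (U n) (\<Pi>\<^sub>M i\<in>{1..n}. N) (\<lambda>w. \<lambda>i\<in>{1..n}. Z i w)"
    and I: "\<And>n. finite (I n)"
    and \<phi>: "\<And>n l. (\<lambda>(u, z). \<phi> n l u z) \<in> borel_measurable (B \<Otimes>\<^sub>M N)"
      "\<And>n l u z. \<phi> n l u z \<in> {0..1}"
    and \<mu>: "\<And>n l u i. u \<in> space B \<Longrightarrow> i \<ge> 1 \<Longrightarrow> expectation (\<lambda>w. \<phi> n l u (Z i w)) = \<mu> n l u"
    and r: "\<And>n. r n \<ge> 0"
    and summ: "summable (\<lambda>n. real (card (I n)) * (2 * exp (- 2 * real n * (r n)\<^sup>2)))"
  shows "AE w in M. \<forall>\<^sub>F n in sequentially. \<forall>l\<in>I n.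
    \<bar>(\<Sum>i=1..n. \<phi> n l (U n w) (Z i w)) / real n - \<mu> n l (U n w)\<bar> \<le> r n"
proof -
  let ?p = "\<lambda>n. real (card (I n)) * (2 * exp (- 2 * real n * (r n)\<^sup>2))"
  let ?V = "\<lambda>n w. \<lambda>i\<in>{1..n}. Z i w"
  define S where "S n = {x \<in> space (B \<Otimes>\<^sub>M (\<Pi>\<^sub>M i\<in>{1..n}. N)). \<exists>l\<in>I n.
    r n \<le> \<bar>(\<Sum>i=1..n. \<phi> n l (fst x) (snd x i)) / real n - \<mu> n l (fst x)\<bar>}" for n
  \<comment> \<open>The bad event at sample size \<open>n\<close>. It is set to be empty at
    \<open>n = 0\<close>, because independence of \<open>U n\<close> from the sample is given from
    index 1 on.\<close>
  define A where "A n = (if n \<ge> 1 then {w \<in> space M. (U n w, ?V n w) \<in> S n} else {})" for n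
  note \<phi>(1)[measurable]
  have Z[measurable]: "Z i \<in> measurable M N" if "i \<ge> 1" for i
    using indep that by (auto simp: indep_vars_def)
  \<comment> \<open>On \<open>space B\<close> the function \<open>\<mu> n l\<close> equals an
    expectation with parameter \<open>u\<close>. Any sample index represents it; index 1 is
    taken.\<close>
  have \<mu>_meas[measurable]: "\<mu> n l \<in> borel_measurable B" for n l
  proof -
    have "(\<lambda>u. expectation (\<lambda>w. \<phi> n l u (Z 1 w))) \<in> borel_measurable B"
      using Z[of 1] by measurable
    moreover have "(\<lambda>u. expectation (\<lambda>w. \<phi> n l u (Z 1 w))) \<in> borel_measurable B \<longleftrightarrow> \<mu> n l \<in> borel_measurable B"
      by (rule measurable_cong) (rule \<mu>, simp_all)
    ultimately show ?thesis by simp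
  qed
  have S[measurable]: "S n \<in> sets (B \<Otimes>\<^sub>M (\<Pi>\<^sub>M i\<in>{1..n}. N))" for n
    unfolding S_def using I[of n] by measurable
  have UV[measurable]: "U n \<in> measurable M B" "?V n \<in> measurable M (\<Pi>\<^sub>M i\<in>{1..n}. N)" if "n \<ge> 1" for n
    using U[OF that] by (auto simp: indep_rvs_def)
  have A: "A n \<in> events" for n
  proof (cases "n \<ge> 1")
    case True
    then have "{w \<in> space M. (U n w, ?V n w) \<in> S n} \<in> events" by measurable
    with True show ?thesis by (simp only: A_def if_True)
  qed (simp add: A_def)
  have bound: "prob (A n) \<le> ?p n" for n
  proof (cases "n \<ge> 1")
    case True
    have "prob {w \<in> space M. (u, ?V n w) \<in> S n} \<le> ?p n" if u: "u \<in> space B" for u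
    proof -
      let ?E = "\<lambda>l. {w \<in> space M. r n \<le> \<bar>(\<Sum>i=1..n. \<phi> n l u (Z i w)) / real n - \<mu> n l u\<bar>}"
      have \<phi>u: "\<phi> n l u \<in> borel_measurable N" for l
        using measurable_compose[OF measurable_Pair1'[OF u] \<phi>(1)[of n l]] by simp
      have E: "?E l \<in> events" for l
        using Z \<phi>u by measurable
      have "{w \<in> space M. (u, ?V n w) \<in> S n} \<subseteq> (\<Union>l\<in>I n. ?E l)"
        by (auto simp: S_def)
      then have "prob {w \<in> space M. (u, ?V n w) \<in> S n} \<le> prob (\<Union>l\<in>I n. ?E l)"
        using E I by (intro finite_measure_mono) auto
      also have "\<dots> \<le> (\<Sum>l\<in>I n. prob (?E l))"
        using E I by (intro finite_measure_subadditive_finite) auto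
      also have "\<dots> \<le> (\<Sum>l\<in>I n. 2 * exp (- 2 * real n * (r n)\<^sup>2))"
        by (intro sum_mono prob_mean_deviation_le[where N = N] indep_vars_subset[OF indep])
           (use True r \<phi>(2) \<phi>u \<mu>[OF u] in auto)
      finally show ?thesis by simp
    qed
    then show ?thesis
      using True prob_indep_rvs_le[OF U[OF True] S[of n]] by (simp add: A_def)
  qed (simp add: A_def)
  have "summable (\<lambda>n. prob (A n))"
    by (rule summable_comparison_test[OF _ summ]) (use bound in \<open>auto intro!: exI[of _ 0]\<close>)
  then have "AE w in M. \<forall>\<^sub>F n in sequentially. w \<in> space M - A n"
    using A by (intro borel_cantelli_AE1) (auto simp: emeasure_eq_measure)
  then show ?thesis
  proof (rule AE_mp, intro AE_I2 impI)
    fix w assume w: "w \<in> space M" and ev: "\<forall>\<^sub>F n in sequentially. w \<in> space M - A n"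
    show "\<forall>\<^sub>F n in sequentially. \<forall>l\<in>I n.
      \<bar>(\<Sum>i=1..n. \<phi> n l (U n w) (Z i w)) / real n - \<mu> n l (U n w)\<bar> \<le> r n"
      using ev eventually_ge_at_top[of 1]
    proof eventually_elim
      case (elim n)
      \<comment> \<open>\<open>S n\<close> is cut down to the product space, so lying outside
        \<open>S n\<close> means a small deviation only for points of that space.\<close>
      then have "(U n w, ?V n w) \<in> space (B \<Otimes>\<^sub>M (\<Pi>\<^sub>M i\<in>{1..n}. N))"
        unfolding space_pair_measure
        using measurable_space[OF UV(1) w] measurable_space[OF UV(2) w] by blast
      with elim w show ?case
        by (force simp: A_def S_def)
    qed
  qed
qed

section \<open>Step approximation of monotone functions\<close>

text \<open>Points of mesh \<open>1 / n\<close> starting at \<open>- n\<close>; the indices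
  \<open>0\<close> to \<open>2 * n^2\<close> sweep the interval from \<open>- n\<close> to
  \<open>n\<close>.\<close>

definition grid :: "nat \<Rightarrow> nat \<Rightarrow> real" where
  "grid n l = real l / real n - real n"

text \<open>Weights of the half-line indicators in the step approximation of \<open>f\<close>: nonnegative with sum
  at most 1 when \<open>f\<close> is monotone with values in \<open>[0, 1]\<close>, which is what makes half-lines suffice.\<close>
definition jump :: "(real \<Rightarrow> real) \<Rightarrow> nat \<Rightarrow> nat \<Rightarrow> real" where
  "jump f n l = (if l = 0 then f (grid n 0) else f (grid n l) - f (grid n (l - 1)))"

lemma sum_jump: "(\<Sum>l\<le>k. jump f n l) = f (grid n k)"
  by (induction k) (simp_all add: jump_def)

lemma jump_nonneg:
  assumes "mono f" "\<And>t. f t \<ge> 0"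
  shows "jump f n l \<ge> 0"
proof -
  have "grid n (l - 1) \<le> grid n l"
    by (auto simp: grid_def intro!: divide_right_mono)
  then show ?thesis using assms by (auto simp: jump_def dest: monoD)
qed

text \<open>The half-lines containing \<open>t\<close> are those starting at or before the last grid
  point not exceeding \<open>t\<close>, so the sum telescopes to the value of \<open>f\<close>
  there. Between \<open>- n\<close> and \<open>n\<close> this point is within \<open>1 / n\<close>
  of \<open>t\<close>, and the Lipschitz bound applies. Outside, the error is at most 1 and one of
  the two tail terms equals 1.\<close>

lemma step_approx:
  assumes f: "mono f" "L-lipschitz_on UNIV f" "range f \<subseteq> {0..1}" and n: "n \<ge> 1"
  shows "\<bar>f t - (\<Sum>l\<le>2 * n\<^sup>2. jump f n l * indicat_real {grid n l..} t)\<bar>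
    \<le> L / real n + (1 - indicat_real {grid n 0..} t) + indicat_real {grid n (2 * n\<^sup>2)..} t"
proof -
  let ?N = "2 * n\<^sup>2"
  have L: "L \<ge> 0" using f(2) by (rule lipschitz_on_nonneg)
  have Ln: "0 \<le> L / real n" using L by simp
  have r: "0 \<le> f x" "f x \<le> 1" for x using f(3) by (auto simp: image_subset_iff)
  have gN: "grid n ?N = real n" using n by (simp add: grid_def power2_eq_square)
  have g0: "grid n 0 = - real n" by (simp add: grid_def)
  show ?thesis
  proof (cases "t < - real n")
    case True
    have "grid n l > t" for l
    proof -
      have "real l / real n \<ge> 0" by simp
      then show ?thesis using True unfolding grid_def by linarith
    qed
    then have "(\<Sum>l\<le>?N. jump f n l * indicat_real {grid n l..} t) = 0"
      by (intro sum.neutral) (auto simp: not_le)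
    then show ?thesis using True r[of t] Ln by (simp add: g0 gN)
  next
    case False
    \<comment> \<open>Index of the last grid point at or below \<open>t\<close>; the floor is
      nonnegative here because \<open>t \<ge> - n\<close>.\<close>
    define k where "k = nat \<lfloor>(t + real n) * real n\<rfloor>"
    have nn: "0 \<le> (t + real n) * real n" using False by simp
    have k: "real k \<le> (t + real n) * real n" "(t + real n) * real n < real k + 1"
      using nn unfolding k_def by linarith+
    have iff: "grid n l \<le> t \<longleftrightarrow> l \<le> k" for l
    proof -
      have "grid n l \<le> t \<longleftrightarrow> real l \<le> (t + real n) * real n"
        using n by (simp add: grid_def field_simps)
      also have "\<dots> \<longleftrightarrow> l \<le> k" using k by linarith
      finally show ?thesis .
    qed
    have "(\<Sum>l\<le>?N. jump f n l * indicat_real {grid n l..} t) = (\<Sum>l\<in>{..?N} \<inter> {..k}. jump f n l)"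
      by (auto simp: indicator_def iff sum.If_cases intro!: sum.cong)
    \<comment> \<open>The cap at \<open>2 * n^2\<close> matters for \<open>t \<ge> n\<close>, where
      all half-lines of the family contain \<open>t\<close> and the sum stops at the last grid
      point.\<close>
    also have "{..?N} \<inter> {..k} = {..min ?N k}" by auto
    finally have S: "(\<Sum>l\<le>?N. jump f n l * indicat_real {grid n l..} t) = f (grid n (min ?N k))"
      by (simp add: sum_jump)
    show ?thesis
    proof (cases "k \<ge> ?N")
      case True
      then have "indicat_real {grid n ?N..} t = (1::real)" using iff by simp
      then show ?thesis using r[of t] r[of "grid n ?N"] L False True by (auto simp: S abs_le_iff g0 add_increasing)
    next
      case False2: False
      have "\<bar>t - grid n k\<bar> \<le> 1 / real n"
      proof -
        have "t - grid n k = ((t + real n) * real n - real k) / real n"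
          using n by (simp add: grid_def field_simps)
        then show ?thesis using k by (simp add: divide_right_mono)
      qed
      moreover have "\<bar>f t - f (grid n k)\<bar> \<le> L * \<bar>t - grid n k\<bar>"
        using lipschitz_onD[OF f(2), of t "grid n k"] by (simp add: dist_real_def)
      ultimately have "\<bar>f t - f (grid n k)\<bar> \<le> L / real n"
        using mult_left_mono[OF _ L, of "\<bar>t - grid n k\<bar>" "1 / real n"] by simp
      then show ?thesis using False False2 by (simp add: S g0 add_increasing2)
    qed
  qed
qed

text \<open>The pointwise approximation integrated. A weight with values in \<open>[0, 1]\<close>
  can only shrink the pointwise error, so the bound does not involve \<open>W\<close>.\<close>

lemma (in prob_space) expectation_step_approx:
  assumes f: "mono f" "L-lipschitz_on UNIV f" "range f \<subseteq> {0..1}" and n: "n \<ge> 1"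
    and T[measurable]: "T \<in> borel_measurable M" and W[measurable]: "W \<in> borel_measurable M"
    and W01: "\<And>x. x \<in> space M \<Longrightarrow> W x \<in> {0..1}"
  shows "\<bar>expectation (\<lambda>x. f (T x) * W x)
      - (\<Sum>l\<le>2 * n\<^sup>2. jump f n l * expectation (\<lambda>x. indicat_real {grid n l..} (T x) * W x))\<bar>
    \<le> L / real n + (1 - expectation (\<lambda>x. indicat_real {grid n 0..} (T x)))
      + expectation (\<lambda>x. indicat_real {grid n (2 * n\<^sup>2)..} (T x))"
proof -
  have [measurable]: "f \<in> borel_measurable borel"
    using f(1) by (rule borel_measurable_mono)
  have r: "0 \<le> f x" "f x \<le> 1" for x using f(3) by (auto simp: image_subset_iff)
  have int1: "integrable M (\<lambda>x. f (T x) * W x)"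
    by (rule integrable_const_bound[where B = 1])
       (use W01 r in \<open>auto simp: abs_mult intro!: AE_I2 mult_le_one\<close>)
  have int2: "integrable M (\<lambda>x. indicator {a..} (T x) * W x)" for a :: real
    by (rule integrable_const_bound[where B = 1])
       (use W01 in \<open>auto simp: indicator_def intro!: AE_I2\<close>)
  have int3: "integrable M (\<lambda>x. indicator {a..} (T x) :: real)" for a :: real
    by (rule integrable_const_bound[where B = 1]) (auto simp: indicator_def)
  let ?d = "\<lambda>x. f (T x) * W x - (\<Sum>l\<le>2 * n\<^sup>2. jump f n l * (indicat_real {grid n l..} (T x) * W x))"
  have "expectation (\<lambda>x. f (T x) * W x)
      - (\<Sum>l\<le>2 * n\<^sup>2. jump f n l * expectation (\<lambda>x. indicat_real {grid n l..} (T x) * W x)) = expectation ?d"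
    using int1 int2 by (simp add: Bochner_Integration.integral_diff Bochner_Integration.integral_sum)
  also have "\<bar>\<dots>\<bar> \<le> expectation (\<lambda>x. \<bar>?d x\<bar>)"
    by (rule integral_abs_bound)
  also have "\<dots> \<le> expectation (\<lambda>x. L / real n + (1 - indicat_real {grid n 0..} (T x)) + indicat_real {grid n (2 * n\<^sup>2)..} (T x))"
  proof (rule integral_mono)
    fix x assume x: "x \<in> space M"
    let ?e = "f (T x) - (\<Sum>l\<le>2 * n\<^sup>2. jump f n l * indicat_real {grid n l..} (T x))"
    have "?d x = ?e * W x"
      by (simp only: left_diff_distrib sum_distrib_right mult.assoc)
    also have "\<bar>\<dots>\<bar> \<le> \<bar>?e\<bar>"
      using W01[OF x] by (simp add: abs_mult mult_left_le)
    also have "\<dots> \<le> L / real n + (1 - indicat_real {grid n 0..} (T x)) + indicat_real {grid n (2 * n\<^sup>2)..} (T x)"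
      by (rule step_approx) fact+
    finally show "\<bar>?d x\<bar> \<le> \<dots>" .
  qed (use int1 int2 int3 in auto)
  also have "\<dots> = L / real n + (1 - expectation (\<lambda>x. indicat_real {grid n 0..} (T x)))
      + expectation (\<lambda>x. indicat_real {grid n (2 * n\<^sup>2)..} (T x))"
    using int3 by (simp add: Bochner_Integration.integral_add Bochner_Integration.integral_diff prob_space)
  finally show ?thesis .
qed

text \<open>\<open>P\<close> is meant for the sample and \<open>Q\<close> for the population. Both
  integrals are replaced by the same subconvex combination of half-line integrals, which costs
  \<open>r\<close> in between and \<open>L / n\<close> plus tails on each side. The two tails under
  \<open>P\<close> are compared with those under \<open>Q\<close> at a further cost of
  \<open>2 * r\<close>.\<close>

lemma mono_expectation_deviation:
  assumes P: "prob_space P" and Q: "prob_space Q"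
    and f: "mono f" "L-lipschitz_on UNIV f" "range f \<subseteq> {0..1}" and n: "n \<ge> 1"
    and meas: "T \<in> borel_measurable P" "W \<in> borel_measurable P"
      "T' \<in> borel_measurable Q" "W' \<in> borel_measurable Q"
    and W01: "\<And>x. x \<in> space P \<Longrightarrow> W x \<in> {0..1}" "\<And>x. x \<in> space Q \<Longrightarrow> W' x \<in> {0..1}"
    and dev: "\<And>l. l \<le> 2 * n\<^sup>2 \<Longrightarrow>
      \<bar>(\<integral>x. indicat_real {grid n l..} (T x) * W x \<partial>P) - (\<integral>x. indicat_real {grid n l..} (T' x) * W' x \<partial>Q)\<bar> \<le> r"
    and dev1: "\<And>l. l \<le> 2 * n\<^sup>2 \<Longrightarrow>
      \<bar>(\<integral>x. indicat_real {grid n l..} (T x) \<partial>P) - (\<integral>x. indicat_real {grid n l..} (T' x) \<partial>Q)\<bar> \<le> r"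
    and tail: "(1 - (\<integral>x. indicat_real {grid n 0..} (T' x) \<partial>Q)) + (\<integral>x. indicat_real {grid n (2 * n\<^sup>2)..} (T' x) \<partial>Q) \<le> \<tau>"
  shows "\<bar>(\<integral>x. f (T x) * W x \<partial>P) - (\<integral>x. f (T' x) * W' x \<partial>Q)\<bar> \<le> 3 * r + 2 * L / real n + 2 * \<tau>"
proof -
  interpret P: prob_space P by fact
  interpret Q: prob_space Q by fact
  let ?a = "\<lambda>l. \<integral>x. indicat_real {grid n l..} (T x) * W x \<partial>P"
  let ?b = "\<lambda>l. \<integral>x. indicat_real {grid n l..} (T' x) * W' x \<partial>Q"
  have r01: "0 \<le> f x" "f x \<le> 1" for x using f(3) by (auto simp: image_subset_iff)
  have r: "r \<ge> 0" using dev1[of 0] by linarith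
  have J: "jump f n l \<ge> 0" for l using f(1) r01 by (intro jump_nonneg) auto
  have "\<bar>(\<Sum>l\<le>2 * n\<^sup>2. jump f n l * ?a l) - (\<Sum>l\<le>2 * n\<^sup>2. jump f n l * ?b l)\<bar>
      = \<bar>\<Sum>l\<le>2 * n\<^sup>2. jump f n l * (?a l - ?b l)\<bar>"
    by (simp add: sum_subtractf right_diff_distrib)
  also have "\<dots> \<le> (\<Sum>l\<le>2 * n\<^sup>2. jump f n l * r)"
    using J dev by (intro order_trans[OF sum_abs] sum_mono) (auto simp: abs_mult intro!: mult_left_mono)
  \<comment> \<open>The total weight is a single value of \<open>f\<close>, so the number of grid
    points does not multiply the error.\<close>
  also have "\<dots> = f (grid n (2 * n\<^sup>2)) * r"
    by (simp add: sum_distrib_right[symmetric] sum_jump)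
  also have "\<dots> \<le> r" using r r01 by (simp add: mult_left_le_one_le)
  finally have 1: "\<bar>(\<Sum>l\<le>2 * n\<^sup>2. jump f n l * ?a l) - (\<Sum>l\<le>2 * n\<^sup>2. jump f n l * ?b l)\<bar> \<le> r" .
  have 2: "\<bar>(\<integral>x. f (T x) * W x \<partial>P) - (\<Sum>l\<le>2 * n\<^sup>2. jump f n l * ?a l)\<bar>
     \<le> L / real n + (1 - (\<integral>x. indicat_real {grid n 0..} (T x) \<partial>P)) + (\<integral>x. indicat_real {grid n (2 * n\<^sup>2)..} (T x) \<partial>P)"
    by (rule P.expectation_step_approx) (use f n meas W01 in auto)
  have 3: "\<bar>(\<integral>x. f (T' x) * W' x \<partial>Q) - (\<Sum>l\<le>2 * n\<^sup>2. jump f n l * ?b l)\<bar>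
     \<le> L / real n + (1 - (\<integral>x. indicat_real {grid n 0..} (T' x) \<partial>Q)) + (\<integral>x. indicat_real {grid n (2 * n\<^sup>2)..} (T' x) \<partial>Q)"
    by (rule Q.expectation_step_approx) (use f n meas W01 in auto)
  show ?thesis
    using 1 2 3 dev1[of 0] dev1[of "2 * n\<^sup>2"] tail by (simp add: abs_le_iff)
qed

section \<open>Link functions and the excess risk of the least squares minimiser\<close>

lemma link_classD:
  assumes "\<sigma> \<in> link_class L"
  shows "mono \<sigma>" "L-lipschitz_on UNIV \<sigma>" "range \<sigma> \<subseteq> {0..1}" "0 \<le> \<sigma> t" "\<sigma> t \<le> 1"
    "\<sigma> (- t) = 1 - \<sigma> t" "\<sigma> \<in> borel_measurable borel" "\<bar>\<sigma> s - \<sigma> t\<bar> \<le> L * \<bar>s - t\<bar>"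
proof -
  have *: "mono \<sigma>" "L-lipschitz_on UNIV \<sigma>" "range \<sigma> \<subseteq> {0..1}" "\<forall>t. \<sigma> t + \<sigma> (- t) = 1"
    using assms by (simp_all add: link_class_def)
  then show "mono \<sigma>" "L-lipschitz_on UNIV \<sigma>" "range \<sigma> \<subseteq> {0..1}" "0 \<le> \<sigma> t" "\<sigma> t \<le> 1"
    by (auto simp: image_subset_iff)
  show "\<sigma> (- t) = 1 - \<sigma> t" using *(4)[rule_format, of t] by linarith
  show "\<sigma> \<in> borel_measurable borel" using *(1) by (rule borel_measurable_mono)
  show "\<bar>\<sigma> s - \<sigma> t\<bar> \<le> L * \<bar>s - t\<bar>"
    using lipschitz_onD[OF *(2), of s t] by (simp add: dist_real_def)
qed

text \<open>Nonnegative monotone factors have a monotone product, and the product rule with factors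
  bounded by 1 adds the two Lipschitz constants. This lets squared differences of links be expanded
  into functions covered by the step approximation.\<close>

lemma link_class_mult:
  assumes \<sigma>: "\<sigma> \<in> link_class L" and \<rho>: "\<rho> \<in> link_class L"
  shows "mono (\<lambda>t. \<sigma> t * \<rho> t)" "(2 * L)-lipschitz_on UNIV (\<lambda>t. \<sigma> t * \<rho> t)"
    "range (\<lambda>t. \<sigma> t * \<rho> t) \<subseteq> {0..1}"
proof -
  note s = link_classD[OF \<sigma>] and r = link_classD[OF \<rho>]
  show "mono (\<lambda>t. \<sigma> t * \<rho> t)"
    using s(1,4) r(1,4) by (intro monoI mult_mono) (auto dest: monoD)
  show "range (\<lambda>t. \<sigma> t * \<rho> t) \<subseteq> {0..1}"
    using s(4,5) r(4,5) by (auto intro!: mult_le_one)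
  show "(2 * L)-lipschitz_on UNIV (\<lambda>t. \<sigma> t * \<rho> t)"
  proof (rule lipschitz_onI)
    fix x y :: real
    have "\<sigma> x * \<rho> x - \<sigma> y * \<rho> y = (\<sigma> x - \<sigma> y) * \<rho> x + \<sigma> y * (\<rho> x - \<rho> y)"
      by (simp add: algebra_simps)
    also have "\<bar>\<dots>\<bar> \<le> \<bar>\<sigma> x - \<sigma> y\<bar> * \<rho> x + \<sigma> y * \<bar>\<rho> x - \<rho> y\<bar>"
      using s(4) r(4) by (intro order_trans[OF abs_triangle_ineq]) (simp add: abs_mult)
    also have "\<dots> \<le> \<bar>\<sigma> x - \<sigma> y\<bar> + \<bar>\<rho> x - \<rho> y\<bar>"
      using s(4,5) r(4,5) by (intro add_mono mult_left_le mult_left_le_one_le) auto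
    also have "\<dots> \<le> L * \<bar>x - y\<bar> + L * \<bar>x - y\<bar>"
      using s(8) r(8) by (intro add_mono)
    finally show "dist (\<sigma> x * \<rho> x) (\<sigma> y * \<rho> y) \<le> 2 * L * dist x y"
      by (simp add: dist_real_def)
  qed (use lipschitz_on_nonneg[OF s(2)] in simp)
qed

text \<open>At most one of the two terms on the left is 1, and then
  \<open>\<bar>t\<bar> \<ge> n\<close>. This is Chebyshev's bound before integration.\<close>

lemma tail_indicator_le:
  assumes "n \<ge> 1"
  shows "(1 - indicat_real {grid n 0..} t) + indicat_real {grid n (2 * n\<^sup>2)..} t \<le> t\<^sup>2 / (real n)\<^sup>2"
proof -
  have gN: "grid n (2 * n\<^sup>2) = real n" and g0: "grid n 0 = - real n"
    using assms by (simp_all add: grid_def power2_eq_square)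
  have "1 \<le> t\<^sup>2 / (real n)\<^sup>2" if "\<bar>t\<bar> \<ge> real n"
  proof -
    have "(real n)\<^sup>2 \<le> t\<^sup>2" using that by (simp add: abs_le_square_iff[symmetric])
    then show ?thesis using assms by (simp add: field_simps)
  qed
  moreover have "0 \<le> t\<^sup>2 / (real n)\<^sup>2" by simp
  ultimately show ?thesis using assms unfolding gN g0 by (auto simp: indicator_def)
qed

text \<open>The basic inequality of least squares at the misspecified direction \<open>u\<close>. Expanded products of links
  along \<open>u\<close> are again monotone, so deviations over half-spaces control every term; in the noise term the
  population parts cancel because \<open>b\<close> and \<open>g\<^sub>j (us \<bullet> x)\<close> have the same averages over half-spaces.\<close>
lemma erm_excess_le:
  fixes Q :: "(real^'d) measure" and u us :: "real^'d" and x :: "nat \<Rightarrow> real^'d"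
    and b :: "nat \<Rightarrow> nat \<Rightarrow> real" and s g :: "nat \<Rightarrow> real \<Rightarrow> real"
  assumes Q: "prob_space Q" "sets Q = sets borel" "integrable Q (\<lambda>x. (norm x)\<^sup>2)"
    and n: "n \<ge> 1" and u: "norm u \<le> 2"
    and sg: "\<And>j. j \<in> {1..m} \<Longrightarrow> s j \<in> link_class L" "\<And>j. j \<in> {1..m} \<Longrightarrow> g j \<in> link_class L"
    and b: "\<And>i j. b i j \<in> {0..1}"
    and dev1: "\<And>l. l \<le> 2 * n\<^sup>2 \<Longrightarrow>
      \<bar>(\<Sum>i=1..n. indicat_real {grid n l..} (u \<bullet> x i)) / real n - (\<integral>x. indicat_real {grid n l..} (u \<bullet> x) \<partial>Q)\<bar> \<le> r"
    and devB: "\<And>j l. j \<in> {1..m} \<Longrightarrow> l \<le> 2 * n\<^sup>2 \<Longrightarrow>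
      \<bar>(\<Sum>i=1..n. indicat_real {grid n l..} (u \<bullet> x i) * b i j) / real n
        - (\<integral>x. indicat_real {grid n l..} (u \<bullet> x) * g j (us \<bullet> x) \<partial>Q)\<bar> \<le> r"
    and devW: "\<And>j l. j \<in> {1..m} \<Longrightarrow> l \<le> 2 * n\<^sup>2 \<Longrightarrow>
      \<bar>(\<Sum>i=1..n. indicat_real {grid n l..} (u \<bullet> x i) * g j (us \<bullet> x i)) / real n
        - (\<integral>x. indicat_real {grid n l..} (u \<bullet> x) * g j (us \<bullet> x) \<partial>Q)\<bar> \<le> r"
    and devh: "\<bar>(\<Sum>i=1..n. min 1 (L\<^sup>2 * ((u - us) \<bullet> x i)\<^sup>2)) / real n
        - (\<integral>x. min 1 (L\<^sup>2 * ((u - us) \<bullet> x)\<^sup>2) \<partial>Q)\<bar> \<le> r"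
    and erm: "(\<Sum>i=1..n. \<Sum>j=1..m. (s j (u \<bullet> x i) - b i j)\<^sup>2) \<le> (\<Sum>i=1..n. \<Sum>j=1..m. (g j (u \<bullet> x i) - b i j)\<^sup>2)"
  defines "V \<equiv> \<integral>x. (norm x)\<^sup>2 \<partial>Q"
  defines "q \<equiv> 3 * r + 4 * L / real n + 8 * V / (real n)\<^sup>2"
  shows "(\<Sum>j=1..m. \<integral>x. (s j (us \<bullet> x) - g j (us \<bullet> x))\<^sup>2 \<partial>Q)
    \<le> real m * (40 * q + 8 * r + 16 * (L\<^sup>2 * (norm (u - us))\<^sup>2 * V))"
proof -
  interpret Q: prob_space Q by fact
  have m_borel: "F \<in> borel_measurable Q" if "F \<in> borel_measurable borel" for F :: "_ \<Rightarrow> real"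
    using that measurable_cong_sets[OF Q(2) refl] by blast
  have spQ: "space Q = UNIV" using sets_eq_imp_space_eq[OF Q(2)] by simp
  \<comment> \<open>Sample averages become integrals over a probability measure on the indices, so
    that sample and population are treated alike.\<close>
  let ?P = "uniform_count_measure {1..n}"
  define E :: "(nat \<Rightarrow> real) \<Rightarrow> real" where "E F = (\<Sum>i=1..n. F i) / real n" for F
  have P: "prob_space ?P"
    by (rule prob_space_uniform_count_measure) (use n in auto)
  have EP: "E F = (\<integral>i. F i \<partial>?P)" for F
    by (subst integral_uniform_count_measure) (simp_all add: E_def)
  have Eadd: "E (\<lambda>i. F i + G i) = E F + E G" and Ediff: "E (\<lambda>i. F i - G i) = E F - E G"
    and Emult: "E (\<lambda>i. c * F i) = c * E F" for F G c
    by (simp_all add: E_def sum.distrib sum_subtractf sum_distrib_left[symmetric] add_divide_distrib diff_divide_distrib)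
  have Esum: "E (\<lambda>i. \<Sum>j=1..m. F i j) = (\<Sum>j=1..m. E (\<lambda>i. F i j))" for F
    unfolding E_def by (subst sum.swap) (simp add: sum_divide_distrib)
  have sq_bound: "(v \<bullet> x)\<^sup>2 \<le> (norm v)\<^sup>2 * (norm x)\<^sup>2" for v x :: "real^'d"
    using power_mono[OF Cauchy_Schwarz_ineq2[of v x], of 2] by (simp add: power_mult_distrib)
  have V: "V \<ge> 0" unfolding V_def by simp
  have int_sq: "integrable Q (\<lambda>x. (v \<bullet> x)\<^sup>2)" for v
  proof (rule Bochner_Integration.integrable_bound)
    show "integrable Q (\<lambda>x. (norm v)\<^sup>2 * (norm x)\<^sup>2)" using Q(3) by simp
    show "(\<lambda>x. (v \<bullet> x)\<^sup>2) \<in> borel_measurable Q" by (rule m_borel) simp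
  qed (use sq_bound in \<open>auto intro!: AE_I2\<close>)
  have int_sq_le: "(\<integral>x. (v \<bullet> x)\<^sup>2 \<partial>Q) \<le> (norm v)\<^sup>2 * V" for v
  proof -
    have "(\<integral>x. (v \<bullet> x)\<^sup>2 \<partial>Q) \<le> (\<integral>x. (norm v)\<^sup>2 * (norm x)\<^sup>2 \<partial>Q)"
      using int_sq Q(3) sq_bound by (intro integral_mono) auto
    then show ?thesis by (simp add: V_def)
  qed
  have ind_meas: "(\<lambda>x. indicator {a..} (u \<bullet> x) :: real) \<in> borel_measurable Q" for a :: real
    by (rule m_borel) measurable
  have tail: "(1 - (\<integral>x. indicat_real {grid n 0..} (u \<bullet> x) \<partial>Q)) + (\<integral>x. indicat_real {grid n (2 * n\<^sup>2)..} (u \<bullet> x) \<partial>Q)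
      \<le> 4 * V / (real n)\<^sup>2"
  proof -
    have int: "integrable Q (\<lambda>x. indicator {a..} (u \<bullet> x) :: real)" for a :: real
      by (rule Q.integrable_const_bound[where B = 1]) (use ind_meas in \<open>auto simp: indicator_def\<close>)
    have "(1 - (\<integral>x. indicat_real {grid n 0..} (u \<bullet> x) \<partial>Q)) + (\<integral>x. indicat_real {grid n (2 * n\<^sup>2)..} (u \<bullet> x) \<partial>Q)
        = (\<integral>x. (1 - indicat_real {grid n 0..} (u \<bullet> x)) + indicat_real {grid n (2 * n\<^sup>2)..} (u \<bullet> x) \<partial>Q)"
      using int by (simp add: Bochner_Integration.integral_add Bochner_Integration.integral_diff Q.prob_space)
    also have "\<dots> \<le> (\<integral>x. (u \<bullet> x)\<^sup>2 / (real n)\<^sup>2 \<partial>Q)"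
      using int int_sq tail_indicator_le[OF n] by (intro integral_mono) auto
    also have "\<dots> \<le> (norm u)\<^sup>2 * V / (real n)\<^sup>2"
      using int_sq_le[of u] by (simp add: divide_right_mono)
    also have "\<dots> \<le> 4 * V / (real n)\<^sup>2"
      using u V power_mono[OF u, of 2] by (intro divide_right_mono mult_right_mono) auto
    finally show ?thesis .
  qed
  \<comment> \<open>The Lipschitz constant \<open>2 * L\<close> covers single links and products of
    two links at once. With \<open>norm u \<le> 2\<close> the tails are at most
    \<open>4 * V / n^2\<close>, which gives \<open>q\<close>.\<close>
  have dev: "\<bar>E (\<lambda>i. f (u \<bullet> x i) * w i) - (\<integral>x. f (u \<bullet> x) * W x \<partial>Q)\<bar> \<le> q"
    if f: "mono f" "(2 * L)-lipschitz_on UNIV f" "range f \<subseteq> {0..1}"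
      and w: "\<And>i. w i \<in> {0..1}" and W: "W \<in> borel_measurable borel" "\<And>x. W x \<in> {0..1}"
      and d: "\<And>l. l \<le> 2 * n\<^sup>2 \<Longrightarrow> \<bar>E (\<lambda>i. indicat_real {grid n l..} (u \<bullet> x i) * w i)
         - (\<integral>x. indicat_real {grid n l..} (u \<bullet> x) * W x \<partial>Q)\<bar> \<le> r" for f w W
  proof -
    have "\<bar>E (\<lambda>i. f (u \<bullet> x i) * w i) - (\<integral>x. f (u \<bullet> x) * W x \<partial>Q)\<bar>
        \<le> 3 * r + 2 * (2 * L) / real n + 2 * (4 * V / (real n)\<^sup>2)"
      unfolding EP
    proof (rule mono_expectation_deviation[OF P Q(1) f n])
      show "(\<lambda>x. u \<bullet> x) \<in> borel_measurable Q" by (rule m_borel) simp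
      show "W \<in> borel_measurable Q" by (rule m_borel) fact
      fix l assume l: "l \<le> 2 * n\<^sup>2"
      show "\<bar>(\<integral>i. indicat_real {grid n l..} (u \<bullet> x i) * w i \<partial>?P)
         - (\<integral>x. indicat_real {grid n l..} (u \<bullet> x) * W x \<partial>Q)\<bar> \<le> r"
        using d[OF l] unfolding EP .
      show "\<bar>(\<integral>i. indicat_real {grid n l..} (u \<bullet> x i) \<partial>?P)
         - (\<integral>x. indicat_real {grid n l..} (u \<bullet> x) \<partial>Q)\<bar> \<le> r"
        using dev1[OF l] unfolding E_def[symmetric] EP .
    qed (use w W(2) tail in \<open>auto simp: measurable_def space_uniform_count_measure sets_uniform_count_measure\<close>)
    then show ?thesis by (simp add: q_def)
  qed
  let ?D = "\<lambda>j t. s j t - g j t"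
  \<comment> \<open>A bound for the squared error made by evaluating a link along \<open>u\<close>
    instead of \<open>us\<close>. The Lipschitz property gives the quadratic term, and the range of
    links gives the cap 1, which keeps the function within the scope of Hoeffding's
    inequality.\<close>
  let ?h = "\<lambda>x. min 1 (L\<^sup>2 * ((u - us) \<bullet> x)\<^sup>2)"
  have L: "L \<ge> 0" if "j \<in> {1..m}" for j
    using lipschitz_on_nonneg[OF link_classD(2)[OF sg(1)[OF that]]] .
  have lip2: "(2 * L)-lipschitz_on UNIV f" if "L-lipschitz_on UNIV f" for f :: "real \<Rightarrow> real"
    using lipschitz_on_nonneg[OF that] by (intro lipschitz_on_le[OF that]) simp
  have int_bdd: "integrable Q F" if "F \<in> borel_measurable borel" "\<And>x. \<bar>F x\<bar> \<le> 1" for F :: "real^'d \<Rightarrow> real"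
    using that by (intro Q.integrable_const_bound[where B = 1] m_borel) auto
  have meas_u: "(\<lambda>x. f (v \<bullet> x)) \<in> borel_measurable borel" if "f \<in> borel_measurable borel" for f :: "real \<Rightarrow> real" and v :: "real^'d"
    using that by simp
  have sq_dev: "\<bar>E (\<lambda>i. (?D j (u \<bullet> x i))\<^sup>2) - (\<integral>x. (?D j (u \<bullet> x))\<^sup>2 \<partial>Q)\<bar> \<le> 4 * q"
    and noise: "E (\<lambda>i. ?D j (u \<bullet> x i) * (b i j - g j (us \<bullet> x i))) \<le> 4 * q"
    and transfer: "(\<integral>x. (?D j (us \<bullet> x))\<^sup>2 \<partial>Q)
      \<le> 2 * (\<integral>x. (?D j (u \<bullet> x))\<^sup>2 \<partial>Q) + 8 * (L\<^sup>2 * (norm (u - us))\<^sup>2 * V)"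
    if j: "j \<in> {1..m}" for j
  proof -
    note sj = sg(1)[OF j] and gj = sg(2)[OF j]
    note s = link_classD[OF sj] and g = link_classD[OF gj]
    have prod_dev: "\<bar>E (\<lambda>i. \<sigma> (u \<bullet> x i) * \<rho> (u \<bullet> x i)) - (\<integral>x. \<sigma> (u \<bullet> x) * \<rho> (u \<bullet> x) \<partial>Q)\<bar> \<le> q"
      and int_prod: "integrable Q (\<lambda>x. \<sigma> (u \<bullet> x) * \<rho> (u \<bullet> x))"
      if "\<sigma> \<in> link_class L" "\<rho> \<in> link_class L" for \<sigma> \<rho>
    proof -
      show "\<bar>E (\<lambda>i. \<sigma> (u \<bullet> x i) * \<rho> (u \<bullet> x i)) - (\<integral>x. \<sigma> (u \<bullet> x) * \<rho> (u \<bullet> x) \<partial>Q)\<bar> \<le> q"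
        using dev[OF link_class_mult[OF that], of "\<lambda>_. 1" "\<lambda>_. 1"] dev1 by (simp add: E_def)
      show "integrable Q (\<lambda>x. \<sigma> (u \<bullet> x) * \<rho> (u \<bullet> x))"
        using link_classD(4,5,7)[OF that(1)] link_classD(4,5,7)[OF that(2)]
        by (intro int_bdd) (auto simp: abs_mult intro!: mult_le_one)
    qed
    \<comment> \<open>Expanding the square gives three products of links with coefficients 1, 2, 1
      in absolute value, hence \<open>4 * q\<close>.\<close>
    have "E (\<lambda>i. (?D j (u \<bullet> x i))\<^sup>2) = E (\<lambda>i. s j (u \<bullet> x i) * s j (u \<bullet> x i))
        - 2 * E (\<lambda>i. s j (u \<bullet> x i) * g j (u \<bullet> x i)) + E (\<lambda>i. g j (u \<bullet> x i) * g j (u \<bullet> x i))"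
      by (simp add: Eadd[symmetric] Ediff[symmetric] Emult[symmetric] power2_eq_square algebra_simps)
    moreover have "(\<integral>x. (?D j (u \<bullet> x))\<^sup>2 \<partial>Q) = (\<integral>x. s j (u \<bullet> x) * s j (u \<bullet> x) \<partial>Q)
        - 2 * (\<integral>x. s j (u \<bullet> x) * g j (u \<bullet> x) \<partial>Q) + (\<integral>x. g j (u \<bullet> x) * g j (u \<bullet> x) \<partial>Q)"
    proof -
      have "(\<integral>x. (?D j (u \<bullet> x))\<^sup>2 \<partial>Q) = (\<integral>x. s j (u \<bullet> x) * s j (u \<bullet> x)
        - 2 * (s j (u \<bullet> x) * g j (u \<bullet> x)) + g j (u \<bullet> x) * g j (u \<bullet> x) \<partial>Q)"
        by (simp add: power2_eq_square algebra_simps)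
      then show ?thesis
        using int_prod[OF sj sj] int_prod[OF sj gj] int_prod[OF gj gj] by simp
    qed
    ultimately show "\<bar>E (\<lambda>i. (?D j (u \<bullet> x i))\<^sup>2) - (\<integral>x. (?D j (u \<bullet> x))\<^sup>2 \<partial>Q)\<bar> \<le> 4 * q"
      using prod_dev[OF sj sj] prod_dev[OF sj gj] prod_dev[OF gj gj] by (simp add: abs_le_iff)
    have wdev: "\<bar>E (\<lambda>i. \<sigma> (u \<bullet> x i) * b i j) - (\<integral>x. \<sigma> (u \<bullet> x) * g j (us \<bullet> x) \<partial>Q)\<bar> \<le> q"
      "\<bar>E (\<lambda>i. \<sigma> (u \<bullet> x i) * g j (us \<bullet> x i)) - (\<integral>x. \<sigma> (u \<bullet> x) * g j (us \<bullet> x) \<partial>Q)\<bar> \<le> q"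
      if "\<sigma> \<in> link_class L" for \<sigma>
    proof -
      note \<sigma> = link_classD[OF that]
      have g01: "g j t \<in> {0..1}" for t using g(4,5) by simp
      have W: "(\<lambda>x. g j (us \<bullet> x)) \<in> borel_measurable borel" using g(7) by (rule meas_u)
      show "\<bar>E (\<lambda>i. \<sigma> (u \<bullet> x i) * b i j) - (\<integral>x. \<sigma> (u \<bullet> x) * g j (us \<bullet> x) \<partial>Q)\<bar> \<le> q"
        by (rule dev[OF \<sigma>(1) lip2[OF \<sigma>(2)] \<sigma>(3) b W g01])
           (rule devB[OF j, folded E_def])
      show "\<bar>E (\<lambda>i. \<sigma> (u \<bullet> x i) * g j (us \<bullet> x i)) - (\<integral>x. \<sigma> (u \<bullet> x) * g j (us \<bullet> x) \<partial>Q)\<bar> \<le> q"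
        by (rule dev[OF \<sigma>(1) lip2[OF \<sigma>(2)] \<sigma>(3) g01 W g01])
           (rule devW[OF j, folded E_def])
    qed
    \<comment> \<open>Four averages, each within \<open>q\<close> of its population value. The
      values for \<open>b\<close> and for \<open>g j (us \<bullet> x)\<close> coincide, so they
      cancel in pairs and only \<open>4 * q\<close> remains.\<close>
    have "E (\<lambda>i. ?D j (u \<bullet> x i) * (b i j - g j (us \<bullet> x i)))
        = E (\<lambda>i. s j (u \<bullet> x i) * b i j) - E (\<lambda>i. g j (u \<bullet> x i) * b i j)
         - E (\<lambda>i. s j (u \<bullet> x i) * g j (us \<bullet> x i)) + E (\<lambda>i. g j (u \<bullet> x i) * g j (us \<bullet> x i))"
      by (simp add: Eadd[symmetric] Ediff[symmetric] algebra_simps)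
    then show "E (\<lambda>i. ?D j (u \<bullet> x i) * (b i j - g j (us \<bullet> x i))) \<le> 4 * q"
      using wdev[OF sj] wdev[OF gj] by (simp add: abs_le_iff)
    have D1: "\<bar>?D j t\<bar> \<le> 1" for t using s(4,5)[of t] g(4,5)[of t] by (simp add: abs_le_iff)
    have int: "integrable Q (\<lambda>x. (?D j (v \<bullet> x))\<^sup>2)" for v
      using s(7) g(7) D1 by (intro int_bdd) (simp_all add: abs_square_le_1)
    \<comment> \<open>Change of direction: \<open>c^2 \<le> 2 * a^2 + 2 * (c - a)^2\<close>, where
      \<open>c - a\<close> is controlled by \<open>2 * L\<close> times the inner product with
      \<open>u - us\<close>.\<close>
    have "(\<integral>x. (?D j (us \<bullet> x))\<^sup>2 \<partial>Q) \<le> (\<integral>x. 2 * (?D j (u \<bullet> x))\<^sup>2 + 8 * L\<^sup>2 * ((u - us) \<bullet> x)\<^sup>2 \<partial>Q)"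
    proof (rule integral_mono)
      show "integrable Q (\<lambda>x. (?D j (us \<bullet> x))\<^sup>2)" by (rule int)
      show "integrable Q (\<lambda>x. 2 * (?D j (u \<bullet> x))\<^sup>2 + 8 * L\<^sup>2 * ((u - us) \<bullet> x)\<^sup>2)"
        using int[of u] int_sq[of "u - us"] by simp
      fix y :: "real^'d"
      let ?a = "?D j (u \<bullet> y)" and ?c = "?D j (us \<bullet> y)" and ?e = "(u - us) \<bullet> y"
      have e: "\<bar>us \<bullet> y - u \<bullet> y\<bar> = \<bar>?e\<bar>" by (simp add: inner_diff_left)
      have "\<bar>?c - ?a\<bar> \<le> 2 * L * \<bar>?e\<bar>"
        using s(8)[of "us \<bullet> y" "u \<bullet> y"] g(8)[of "us \<bullet> y" "u \<bullet> y"] unfolding e by (simp add: abs_le_iff)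
      from power_mono[OF this, of 2] have "(?c - ?a)\<^sup>2 \<le> 4 * L\<^sup>2 * ?e\<^sup>2"
        by (simp add: power_mult_distrib)
      moreover have "?c\<^sup>2 \<le> 2 * ?a\<^sup>2 + 2 * (?c - ?a)\<^sup>2"
        using zero_le_power2[of "?c - 2 * ?a"] by (simp add: power2_eq_square algebra_simps)
      ultimately show "?c\<^sup>2 \<le> 2 * ?a\<^sup>2 + 8 * L\<^sup>2 * ?e\<^sup>2" by linarith
    qed
    also have "\<dots> = 2 * (\<integral>x. (?D j (u \<bullet> x))\<^sup>2 \<partial>Q) + 8 * L\<^sup>2 * (\<integral>x. ((u - us) \<bullet> x)\<^sup>2 \<partial>Q)"
      using int[of u] int_sq[of "u - us"] by simp
    also have "\<dots> \<le> 2 * (\<integral>x. (?D j (u \<bullet> x))\<^sup>2 \<partial>Q) + 8 * L\<^sup>2 * ((norm (u - us))\<^sup>2 * V)"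
      by (intro add_mono mult_left_mono int_sq_le) auto
    finally show "(\<integral>x. (?D j (us \<bullet> x))\<^sup>2 \<partial>Q)
      \<le> 2 * (\<integral>x. (?D j (u \<bullet> x))\<^sup>2 \<partial>Q) + 8 * (L\<^sup>2 * (norm (u - us))\<^sup>2 * V)" by (simp add: mult.assoc)
  qed
  have h: "E (\<lambda>i. ?h (x i)) \<le> L\<^sup>2 * (norm (u - us))\<^sup>2 * V + r"
  proof -
    have "(\<integral>x. ?h x \<partial>Q) \<le> (\<integral>x. L\<^sup>2 * ((u - us) \<bullet> x)\<^sup>2 \<partial>Q)"
    proof (rule integral_mono)
      show "integrable Q ?h" by (rule int_bdd) auto
      show "integrable Q (\<lambda>x. L\<^sup>2 * ((u - us) \<bullet> x)\<^sup>2)" using int_sq[of "u - us"] by simp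
    qed simp
    also have "\<dots> \<le> L\<^sup>2 * ((norm (u - us))\<^sup>2 * V)"
      using int_sq_le by (simp add: mult_left_mono)
    finally show ?thesis using devh by (simp add: E_def mult.assoc)
  qed
  \<comment> \<open>Completing the square. The cross term between the difference of the links and
    the misspecification error \<open>d\<close> is absorbed into half of the quadratic term at the
    price \<open>4 * d^2\<close>, so that only noise centred along the true direction
    \<open>us\<close> remains.\<close>
  have pt: "(?D j (u \<bullet> y))\<^sup>2 - 4 * (?D j (u \<bullet> y) * (\<beta> - g j (us \<bullet> y))) - 4 * ?h y
      \<le> 2 * ((s j (u \<bullet> y) - \<beta>)\<^sup>2 - (g j (u \<bullet> y) - \<beta>)\<^sup>2)" if j: "j \<in> {1..m}" for j y \<beta>
  proof -
    note g = link_classD[OF sg(2)[OF j]]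
    define d where "d = g j (us \<bullet> y) - g j (u \<bullet> y)"
    have "\<bar>d\<bar> \<le> L * \<bar>(u - us) \<bullet> y\<bar>"
      using g(8)[of "us \<bullet> y" "u \<bullet> y"] by (simp add: d_def inner_diff_left abs_minus_commute)
    from power_mono[OF this, of 2] have "d\<^sup>2 \<le> L\<^sup>2 * ((u - us) \<bullet> y)\<^sup>2"
      by (simp add: power_mult_distrib)
    moreover have "d\<^sup>2 \<le> 1"
      using g(4,5)[of "us \<bullet> y"] g(4,5)[of "u \<bullet> y"] by (simp add: d_def abs_square_le_1 abs_le_iff)
    ultimately have d: "d\<^sup>2 \<le> ?h y" by simp
    have "2 * ((s j (u \<bullet> y) - \<beta>)\<^sup>2 - (g j (u \<bullet> y) - \<beta>)\<^sup>2)
        = (?D j (u \<bullet> y))\<^sup>2 - 4 * (?D j (u \<bullet> y) * (\<beta> - g j (us \<bullet> y))) - 4 * d\<^sup>2 + (?D j (u \<bullet> y) - 2 * d)\<^sup>2"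
      by (simp add: d_def power2_eq_square algebra_simps)
    then show ?thesis using d zero_le_power2[of "?D j (u \<bullet> y) - 2 * d"] by linarith
  qed
  have "(\<Sum>j=1..m. E (\<lambda>i. (?D j (u \<bullet> x i))\<^sup>2 - 4 * (?D j (u \<bullet> x i) * (b i j - g j (us \<bullet> x i))) - 4 * ?h (x i)))
      = E (\<lambda>i. \<Sum>j=1..m. (?D j (u \<bullet> x i))\<^sup>2 - 4 * (?D j (u \<bullet> x i) * (b i j - g j (us \<bullet> x i))) - 4 * ?h (x i))"
    by (rule Esum[symmetric])
  also have "\<dots> \<le> E (\<lambda>i. \<Sum>j=1..m. 2 * ((s j (u \<bullet> x i) - b i j)\<^sup>2 - (g j (u \<bullet> x i) - b i j)\<^sup>2))"
    unfolding E_def by (intro divide_right_mono sum_mono pt) auto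
  \<comment> \<open>The minimising property enters here: the expression is \<open>2 / n\<close>
    times the difference of the two empirical losses.\<close>
  also have "\<dots> \<le> 0"
    using erm unfolding E_def
    by (intro divide_nonpos_nonneg) (simp_all add: sum_distrib_left[symmetric] sum_subtractf)
  finally have le0: "(\<Sum>j=1..m. E (\<lambda>i. (?D j (u \<bullet> x i))\<^sup>2)
      - 4 * E (\<lambda>i. ?D j (u \<bullet> x i) * (b i j - g j (us \<bullet> x i))) - 4 * E (\<lambda>i. ?h (x i))) \<le> 0"
    by (simp only: Ediff Emult)
  \<comment> \<open>For each \<open>j\<close>, the quadratic term costs \<open>4 * q\<close> and the
    noise term, with its factor 4, another \<open>16 * q\<close>.\<close>
  have arith: "B - 4 * q - 16 * q - 4 * K \<le> A - 4 * N - 4 * H"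
    if "\<bar>A - B\<bar> \<le> 4 * q" "N \<le> 4 * q" "H \<le> K" for A B N H K :: real
    using that by linarith
  have "(\<Sum>j=1..m. (\<integral>x. (?D j (u \<bullet> x))\<^sup>2 \<partial>Q) - 4 * q - 16 * q - 4 * (L\<^sup>2 * (norm (u - us))\<^sup>2 * V + r))
      \<le> (\<Sum>j=1..m. E (\<lambda>i. (?D j (u \<bullet> x i))\<^sup>2)
      - 4 * E (\<lambda>i. ?D j (u \<bullet> x i) * (b i j - g j (us \<bullet> x i))) - 4 * E (\<lambda>i. ?h (x i)))"
  proof (rule sum_mono)
    fix j assume j: "j \<in> {1..m}"
    show "(\<integral>x. (?D j (u \<bullet> x))\<^sup>2 \<partial>Q) - 4 * q - 16 * q - 4 * (L\<^sup>2 * (norm (u - us))\<^sup>2 * V + r)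
      \<le> E (\<lambda>i. (?D j (u \<bullet> x i))\<^sup>2)
      - 4 * E (\<lambda>i. ?D j (u \<bullet> x i) * (b i j - g j (us \<bullet> x i))) - 4 * E (\<lambda>i. ?h (x i))"
      by (rule arith[OF sq_dev[OF j] noise[OF j] h])
  qed
  then have "(\<Sum>j=1..m. (\<integral>x. (?D j (u \<bullet> x))\<^sup>2 \<partial>Q) - 4 * q - 16 * q - 4 * (L\<^sup>2 * (norm (u - us))\<^sup>2 * V + r)) \<le> 0"
    using le0 by (rule order_trans)
  then have A: "(\<Sum>j=1..m. \<integral>x. (?D j (u \<bullet> x))\<^sup>2 \<partial>Q) \<le> real m * (20 * q + 4 * (L\<^sup>2 * (norm (u - us))\<^sup>2 * V + r))"
    by (simp add: sum_subtractf algebra_simps)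
  \<comment> \<open>Returning to \<open>us\<close> doubles the bound, which gives
    \<open>40 * q\<close> and \<open>8 * r\<close>. The coefficient 16 is this doubled 4 plus the 8
    from the change of direction.\<close>
  have "(\<Sum>j=1..m. \<integral>x. (?D j (us \<bullet> x))\<^sup>2 \<partial>Q)
      \<le> (\<Sum>j=1..m. 2 * (\<integral>x. (?D j (u \<bullet> x))\<^sup>2 \<partial>Q) + 8 * (L\<^sup>2 * (norm (u - us))\<^sup>2 * V))"
    by (intro sum_mono transfer) auto
  also have "\<dots> = 2 * (\<Sum>j=1..m. \<integral>x. (?D j (u \<bullet> x))\<^sup>2 \<partial>Q) + real m * (8 * (L\<^sup>2 * (norm (u - us))\<^sup>2 * V))"
    by (simp add: sum.distrib sum_distrib_left)
  finally show ?thesis using A by (simp add: algebra_simps)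
qed

section \<open>Summable tails, label expectations, the loss over a fresh copy, second
  moments\<close>

text \<open>The exponent contains \<open>n * (n powr - a)^2 = n powr (1 - 2 * a)\<close>, a positive
  power of \<open>n\<close>, so the exponential beats the quadratic number of grid points.\<close>

lemma summable_deviation_bound:
  fixes a :: real
  assumes "0 < a" "a < 1 / 2"
  shows "summable (\<lambda>n. real (card {..2 * n\<^sup>2}) * (2 * exp (- 2 * real n * (real n powr - a)\<^sup>2)))"
proof (rule summable_comparison_test_bigo)
  show "summable (\<lambda>n. norm (real n powr - 2))"
    by (simp add: summable_real_powr_iff)
  have b: "0 < 1 - 2 * a" using assms by simp
  have "(\<lambda>n. (2 * real n ^ 2 + 1) * (2 * exp (- 2 * real n powr (1 - 2 * a)))) \<in> O(\<lambda>n. real n powr - 2)"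
    using b by real_asymp
  moreover have "\<forall>\<^sub>F n in sequentially. real (card {..2 * n\<^sup>2}) * (2 * exp (- 2 * real n * (real n powr - a)\<^sup>2))
     = (2 * real n ^ 2 + 1) * (2 * exp (- 2 * real n powr (1 - 2 * a)))"
    using eventually_gt_at_top[of 0]
  proof eventually_elim
    case (elim n)
    have "real n * (real n powr - a)\<^sup>2 = real n powr (1 - 2 * a)"
      using elim by (simp add: powr_power powr_mult_base)
    then show ?case by (simp add: mult.assoc)
  qed
  ultimately show "(\<lambda>n. real (card {..2 * n\<^sup>2}) * (2 * exp (- 2 * real n * (real n powr - a)\<^sup>2)))
      \<in> O(\<lambda>n. real n powr - 2)"
    by (simp only: landau_o.big.in_cong)
qed

text \<open>\<open>F (X w)\<close> is measurable with respect to the sigma-algebra generated by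
  \<open>X\<close>, so the label indicator may be replaced by its conditional expectation
  \<open>h (X w)\<close> under the integral.\<close>

lemma (in prob_space) expectation_indicator_label:
  fixes F :: "'b \<Rightarrow> real"
  assumes X: "X \<in> measurable M N" and Y: "Y \<in> measurable M label_space"
    and F: "F \<in> borel_measurable N" "\<And>x. \<bar>F x\<bar> \<le> 1"
    and h: "h \<in> borel_measurable N"
    and ce: "AE w in M. real_cond_exp M (sigma_gen M N X) (\<lambda>v. indicat_real {1} (Y v)) w = h (X w)"
  shows "expectation (\<lambda>w. F (X w) * indicator {1} (Y w)) = (\<integral>x. F x * h x \<partial>distr M N X)"
proof -
  let ?F = "sigma_gen M N X"
  have Xs: "X \<in> space M \<rightarrow> space N" using X by (auto dest: measurable_space)
  have sub: "subalgebra M ?F"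
    using sets_image_in_sets[OF refl X] by (auto simp: subalgebra_def)
  interpret S: finite_measure_subalgebra M ?F
    by unfold_locales (rule sub)
  have FX: "(\<lambda>w. F (X w)) \<in> borel_measurable ?F"
    by (rule measurable_compose[OF measurable_vimage_algebra1[OF Xs] F(1)])
  have ind: "(\<lambda>w. indicat_real {1} (Y w)) \<in> borel_measurable M"
    by (rule measurable_compose[OF Y]) simp
  have FXM: "(\<lambda>w. F (X w)) \<in> borel_measurable M" and hXM: "(\<lambda>w. h (X w)) \<in> borel_measurable M"
    using measurable_compose[OF X F(1)] measurable_compose[OF X h] by auto
  have "expectation (\<lambda>w. F (X w) * indicator {1} (Y w))
      = expectation (\<lambda>w. F (X w) * real_cond_exp M ?F (\<lambda>v. indicat_real {1} (Y v)) w)"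
  proof (rule S.real_cond_exp_intg(2)[symmetric, OF _ FX ind])
    show "integrable M (\<lambda>w. F (X w) * indicator {1} (Y w))"
      by (rule integrable_const_bound[where B = 1])
         (use F(2) FXM ind in \<open>auto simp: indicator_def\<close>)
  qed
  also have "\<dots> = expectation (\<lambda>w. F (X w) * h (X w))"
    by (rule integral_cong_AE) (use ce FXM hXM in \<open>auto elim!: eventually_mono\<close>)
  also have "\<dots> = (\<integral>x. F x * h x \<partial>distr M N X)"
    by (rule integral_distr[symmetric]) (use X F h in auto)
  finally show ?thesis .
qed

text \<open>Links satisfy \<open>\<sigma> (- t) = 1 - \<sigma> t\<close>, so a label
  \<open>-1\<close> only changes the sign of the difference of two links, and squaring removes it.
  The loss thus depends on the law of \<open>X 1\<close> alone.\<close>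

lemma link_L2_sq_eq:
  assumes M: "prob_space M" and X: "X 1 \<in> borel_measurable M"
    and Y: "\<And>j. j \<in> {1..m} \<Longrightarrow> Y 1 j \<in> measurable M label_space"
    and obs: "obs m X Y 1 \<in> measurable M (obs_space m)"
    and \<sigma>: "\<And>j. j \<in> {1..m} \<Longrightarrow> \<sigma> j \<in> link_class L" "\<And>j. j \<in> {1..m} \<Longrightarrow> g j \<in> link_class L"
  shows "link_L2_sq (distr M (obs_space m) (obs m X Y 1)) m us \<sigma> g
    = (\<Sum>j=1..m. \<integral>x. (\<sigma> j (us \<bullet> x) - g j (us \<bullet> x))\<^sup>2 \<partial>distr M borel (X 1))"
proof -
  interpret prob_space M by fact
  let ?f = "\<lambda>j y x. (\<sigma> j (y * (us \<bullet> x)) - g j (y * (us \<bullet> x)))\<^sup>2"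
  have meas: "(\<lambda>z. ?f j (snd z j) (fst z)) \<in> borel_measurable (obs_space m)" if j: "j \<in> {1..m}" for j
  proof -
    have [measurable]: "\<sigma> j \<in> borel_measurable borel" "g j \<in> borel_measurable borel"
      using link_classD(7) \<sigma> j by auto
    have "(\<lambda>y. y j) \<in> measurable (\<Pi>\<^sub>M j\<in>{1..m}. label_space) label_space"
      using j by (rule measurable_component_singleton)
    then have "(\<lambda>y. y j) \<in> borel_measurable (\<Pi>\<^sub>M j\<in>{1..m}. label_space)"
      by (rule measurable_compose) simp
    then have [measurable]: "(\<lambda>z. snd z j) \<in> borel_measurable (obs_space m)"
      by (rule measurable_compose[OF measurable_snd])
    show ?thesis by measurable
  qed
  have measX: "(\<lambda>x. ?f j 1 x) \<in> borel_measurable borel" if j: "j \<in> {1..m}" for j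
    using link_classD(7)[OF \<sigma>(1)[OF j]] link_classD(7)[OF \<sigma>(2)[OF j]] by simp
  have "link_L2_sq (distr M (obs_space m) (obs m X Y 1)) m us \<sigma> g
      = expectation (\<lambda>w. \<Sum>j=1..m. ?f j (snd (obs m X Y 1 w) j) (fst (obs m X Y 1 w)))"
    unfolding link_L2_sq_def case_prod_beta
    by (rule integral_distr[OF obs]) (intro borel_measurable_sum meas)
  also have "\<dots> = expectation (\<lambda>w. \<Sum>j=1..m. ?f j 1 (X 1 w))"
  proof (rule Bochner_Integration.integral_cong[OF refl], rule sum.cong[OF refl])
    fix w j assume w: "w \<in> space M" and j: "j \<in> {1..m}"
    have "Y 1 j w \<in> {-1, 1}" using measurable_space[OF Y[OF j] w] by simp
    then show "?f j (snd (obs m X Y 1 w) j) (fst (obs m X Y 1 w)) = ?f j 1 (X 1 w)"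
      using j link_classD(6)[OF \<sigma>(1)[OF j]] link_classD(6)[OF \<sigma>(2)[OF j]]
      by (auto simp: obs_def power2_commute)
  qed
  also have "\<dots> = (\<Sum>j=1..m. expectation (\<lambda>w. ?f j 1 (X 1 w)))"
  proof (rule Bochner_Integration.integral_sum)
    fix j assume j: "j \<in> {1..m}"
    have "\<bar>?f j 1 x\<bar> \<le> 1" for x
      using link_classD(4,5)[OF \<sigma>(1)[OF j], of "us \<bullet> x"] link_classD(4,5)[OF \<sigma>(2)[OF j], of "us \<bullet> x"]
      by (simp add: abs_square_le_1 abs_le_iff)
    then show "integrable M (\<lambda>w. ?f j 1 (X 1 w))"
      by (intro integrable_const_bound[where B = 1] measurable_compose[OF X measX[OF j]]) auto
  qed
  also have "\<dots> = (\<Sum>j=1..m. \<integral>x. ?f j 1 x \<partial>distr M borel (X 1))"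
    using X measX by (intro sum.cong refl integral_distr[symmetric]) auto
  finally show ?thesis by simp
qed

text \<open>Domination by \<open>1 + t powr k\<close>, with the cases \<open>t \<le> 1\<close> and
  \<open>t > 1\<close> treated apart.\<close>

lemma (in prob_space) integrable_norm_sq:
  fixes X :: "'a \<Rightarrow> 'b::euclidean_space"
  assumes X: "X \<in> borel_measurable M" and int: "integrable M (\<lambda>w. norm (X w) powr k)" and k: "k \<ge> 2"
  shows "integrable M (\<lambda>w. (norm (X w))\<^sup>2)"
proof (rule Bochner_Integration.integrable_bound)
  show "integrable M (\<lambda>w. 1 + norm (X w) powr k)" using int by simp
  show "(\<lambda>w. (norm (X w))\<^sup>2) \<in> borel_measurable M" using X by simp
  have "t\<^sup>2 \<le> 1 + t powr k" if "t \<ge> 0" for t :: real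
  proof (cases "t \<le> 1")
    case True
    then have "t\<^sup>2 \<le> 1" using that by (simp add: power_le_one)
    then show ?thesis by (simp add: add_increasing2)
  next
    case False
    then have "t powr 2 \<le> t powr k" using k by (intro powr_mono) auto
    then show ?thesis using False by simp
  qed
  then show "AE w in M. norm ((norm (X w))\<^sup>2) \<le> norm (1 + norm (X w) powr k)"
    by (simp add: add_nonneg_nonneg)
qed

section \<open>The almost sure rate\<close>

theorem proposition5:
  fixes M :: "'w measure"
    and X :: "nat \<Rightarrow> 'w \<Rightarrow> real^'d"
    and Y :: "nat \<Rightarrow> nat \<Rightarrow> 'w \<Rightarrow> real"
    and u_star :: "real^'d"
    and u_init :: "nat \<Rightarrow> 'w \<Rightarrow> real^'d"
    and eps :: "nat \<Rightarrow> 'w \<Rightarrow> real"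
    and Fsp :: "(nat \<Rightarrow> real \<Rightarrow> real) set"
    and \<sigma>_star :: "nat \<Rightarrow> real \<Rightarrow> real"
    and \<sigma>_hat :: "nat \<Rightarrow> 'w \<Rightarrow> nat \<Rightarrow> real \<Rightarrow> real"
    and m :: nat and L k :: real
  assumes M: "prob_space M"
    and u_star: "norm u_star = 1"
    and m: "m \<ge> 1"
    and L: "L > 0"
    and Fsp: "Fsp \<subseteq> (\<Pi>\<^sub>E j\<in>{1..m}. link_class L)"
    and \<sigma>_star: "\<sigma>_star \<in> Fsp"
    and k: "k \<ge> 2"
    and X_meas: "\<And>i. i \<ge> 1 \<Longrightarrow> X i \<in> borel_measurable M"
    and Y_meas: "\<And>i j. i \<ge> 1 \<Longrightarrow> j \<in> {1..m} \<Longrightarrow> Y i j \<in> measurable M label_space"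
    and X_ident: "\<And>i. i \<ge> 1 \<Longrightarrow> distr M borel (X i) = distr M borel (X 1)"
    and X_moment: "integrable M (\<lambda>w. norm (X 1 w) powr k)"
    and obs_indep: "prob_space.indep_vars M (\<lambda>_. obs_space m) (obs m X Y) {1..}"
    and Y_cond_indep: "\<And>i. i \<ge> 1 \<Longrightarrow>
          cond_indep_vars M (sigma_gen M borel (X i)) (\<lambda>_. label_space) (Y i) {1..m}"
    and Y_cond_prob: "\<And>i j y. i \<ge> 1 \<Longrightarrow> j \<in> {1..m} \<Longrightarrow> y \<in> {-1, 1} \<Longrightarrow>
          AE w in M. real_cond_exp M (sigma_gen M borel (X i)) (\<lambda>v. indicat_real {y} (Y i j v)) w
            = \<sigma>_star j (y * (u_star \<bullet> X i w))"
    and u_init_indep: "\<And>n. n \<ge> 1 \<Longrightarrow>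
          indep_rvs M borel (u_init n)
            (\<Pi>\<^sub>M i\<in>{1..n}. obs_space m) (\<lambda>w. \<lambda>i\<in>{1..n}. obs m X Y i w)"
    and eps_meas: "\<And>n. n \<ge> 1 \<Longrightarrow> eps n \<in> borel_measurable M"
    and u_init_err: "AE w in M. \<forall>n\<ge>1. norm (u_init n w - u_star) \<le> eps n w"
    and \<sigma>_hat: "AE w in M. \<forall>n\<ge>1.
          is_arg_min (emp_loss n m (u_init n w) (\<lambda>i. X i w) (\<lambda>i j. Y i j w))
            (\<lambda>\<sigma>. \<sigma> \<in> Fsp) (\<sigma>_hat n w)"
  shows "AE w in M. \<exists>C::real. \<forall>\<^sub>F n in sequentially.
           link_L2_sq (distr M (obs_space m) (obs m X Y 1)) m u_star (\<sigma>_hat n w) \<sigma>_star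
             \<le> C * (real n powr (2 / (3 * k) - 2 / 3) + (eps n w)\<^sup>2
                     + L * real n powr (- (k / (2 * (k + 1)))))"
proof -
  interpret prob_space M by (rule M)
  \<comment> \<open>The exponent of the last term of the rate. Being strictly below
    \<open>1 / 2\<close>, it makes the deviation probabilities at scale \<open>r n\<close>
    summable.\<close>
  define a where "a = k / (2 * (k + 1))"
  have a: "0 < a" "a < 1 / 2" using k by (simp_all add: a_def field_simps)
  define r where "r n = real n powr - a" for n
  define Q where "Q = distr M borel (X 1)"
  define V where "V = (\<integral>x. (norm x)\<^sup>2 \<partial>Q)"
  have Q: "prob_space Q" "sets Q = sets borel"
    unfolding Q_def by (simp_all add: prob_space_distr X_meas)
  have Q_sq: "integrable Q (\<lambda>x. (norm x)\<^sup>2)"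
    using integrable_norm_sq[OF X_meas X_moment k] X_meas[of 1]
    unfolding Q_def by (subst integrable_distr_eq) auto
  have EX: "expectation (\<lambda>w. F (X i w)) = (\<integral>x. F x \<partial>Q)"
    if "i \<ge> 1" "F \<in> borel_measurable borel" for i and F :: "real^'d \<Rightarrow> real"
    using integral_distr[OF X_meas[OF that(1)] that(2)] X_ident[OF that(1)] by (simp add: Q_def)
  have gs: "\<sigma>_star j \<in> link_class L" if "j \<in> {1..m}" for j
    using Fsp \<sigma>_star that by (auto simp: PiE_iff)
  note gl = link_classD[OF gs]
  let ?I = "\<lambda>n l (u :: real^'d) x. indicator {grid n l..} (u \<bullet> x) :: real"
  \<comment> \<open>The common template for the four deviation bounds: the random direction
    \<open>u_init n\<close> is the independent parameter and the grid indices form the finite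
    family.\<close>
  have dev: "AE w in M. \<forall>\<^sub>F n in sequentially. \<forall>l\<in>{..2 * n\<^sup>2}.
      \<bar>(\<Sum>i=1..n. \<phi> n l (u_init n w) (obs m X Y i w)) / real n - \<mu> n l (u_init n w)\<bar> \<le> r n"
    if "\<And>n l. (\<lambda>(u, z). \<phi> n l u z) \<in> borel_measurable (borel \<Otimes>\<^sub>M obs_space m)"
      "\<And>n l u z. \<phi> n l u z \<in> {0..1}"
      "\<And>n l u i. i \<ge> 1 \<Longrightarrow> expectation (\<lambda>w. \<phi> n l u (obs m X Y i w)) = \<mu> n l u"
    for \<phi> :: "nat \<Rightarrow> nat \<Rightarrow> real^'d \<Rightarrow> (real^'d) \<times> (nat \<Rightarrow> real) \<Rightarrow> real" and \<mu>
    by (rule uniform_deviation_AE[OF obs_indep u_init_indep])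
       (use that summable_deviation_bound[OF a] in \<open>auto simp: r_def\<close>)
  have I_meas: "(\<lambda>(u, z). ?I n l u (fst z)) \<in> borel_measurable (borel \<Otimes>\<^sub>M obs_space m)" for n l
    by measurable
  have I_meas': "(\<lambda>x. ?I n l u x) \<in> borel_measurable borel" for n l u
    by measurable
  have AE_all: "AE w in M. \<forall>j\<in>{1..m}. P j w" if "\<And>j. j \<in> {1..m} \<Longrightarrow> AE w in M. P j w" for P
    using that by (simp add: AE_ball_countable)
  have dev1: "AE w in M. \<forall>\<^sub>F n in sequentially. \<forall>l\<in>{..2 * n\<^sup>2}.
      \<bar>(\<Sum>i=1..n. ?I n l (u_init n w) (X i w)) / real n - (\<integral>x. ?I n l (u_init n w) x \<partial>Q)\<bar> \<le> r n"
    using dev[of "\<lambda>n l u z. ?I n l u (fst z)" "\<lambda>n l u. \<integral>x. ?I n l u x \<partial>Q", OF I_meas] EX[OF _ I_meas']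
    by (simp add: obs_def)
  let ?DW = "\<lambda>n j l w. \<bar>(\<Sum>i=1..n. ?I n l (u_init n w) (X i w) * \<sigma>_star j (u_star \<bullet> X i w)) / real n
        - (\<integral>x. ?I n l (u_init n w) x * \<sigma>_star j (u_star \<bullet> x) \<partial>Q)\<bar>"
  have devW: "AE w in M. \<forall>j\<in>{1..m}. \<forall>\<^sub>F n in sequentially. \<forall>l\<in>{..2 * n\<^sup>2}. ?DW n j l w \<le> r n"
  proof (rule AE_all)
    fix j assume j: "j \<in> {1..m}"
    have [measurable]: "\<sigma>_star j \<in> borel_measurable borel" by (rule gl(7)[OF j])
    have m1: "(\<lambda>(u, z). ?I n l u (fst z) * \<sigma>_star j (u_star \<bullet> fst z)) \<in> borel_measurable (borel \<Otimes>\<^sub>M obs_space m)" for n l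
      by measurable
    have m2: "(\<lambda>x. ?I n l u x * \<sigma>_star j (u_star \<bullet> x)) \<in> borel_measurable borel" for n l u
      by measurable
    have b: "?I n l u (fst z) * \<sigma>_star j (u_star \<bullet> fst z) \<in> {0..1}" for n l u and z :: "(real^'d) \<times> (nat \<Rightarrow> real)"
      using gl(4,5)[OF j] by (auto simp: indicator_def)
    show "AE w in M. \<forall>\<^sub>F n in sequentially. \<forall>l\<in>{..2 * n\<^sup>2}. ?DW n j l w \<le> r n"
      using dev[of "\<lambda>n l u z. ?I n l u (fst z) * \<sigma>_star j (u_star \<bullet> fst z)"
          "\<lambda>n l u. \<integral>x. ?I n l u x * \<sigma>_star j (u_star \<bullet> x) \<partial>Q", OF m1 b] EX[OF _ m2]
      by (simp add: obs_def)
  qed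
  let ?DB = "\<lambda>n j l w. \<bar>(\<Sum>i=1..n. ?I n l (u_init n w) (X i w) * indicator {1} (Y i j w)) / real n
        - (\<integral>x. ?I n l (u_init n w) x * \<sigma>_star j (u_star \<bullet> x) \<partial>Q)\<bar>"
  have devB: "AE w in M. \<forall>j\<in>{1..m}. \<forall>\<^sub>F n in sequentially. \<forall>l\<in>{..2 * n\<^sup>2}. ?DB n j l w \<le> r n"
  proof (rule AE_all)
    fix j assume j: "j \<in> {1..m}"
    have h: "(\<lambda>x. \<sigma>_star j (u_star \<bullet> x)) \<in> borel_measurable borel" using gl(7)[OF j] by simp
    have "(\<lambda>y. indicat_real {1} (y j)) \<in> borel_measurable (\<Pi>\<^sub>M j\<in>{1..m}. label_space)"
      by (rule measurable_compose[OF measurable_component_singleton[OF j]]) simp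
    then have [measurable]: "(\<lambda>z. indicat_real {1} (snd z j)) \<in> borel_measurable (obs_space m)"
      by (rule measurable_compose[OF measurable_snd])
    have m1: "(\<lambda>(u, z). ?I n l u (fst z) * indicator {1} (snd z j)) \<in> borel_measurable (borel \<Otimes>\<^sub>M obs_space m)" for n l
      by measurable
    have b: "?I n l u (fst z) * indicator {1} (snd z j) \<in> {0..1}" for n l u and z :: "(real^'d) \<times> (nat \<Rightarrow> real)"
      by (auto simp: indicator_def)
    \<comment> \<open>Conditioning on \<open>X i\<close> turns the label indicator into
      \<open>\<sigma>_star j (u_star \<bullet> X i)\<close>, so the noisy weights have the same
      population mean as the weights in \<open>devW\<close>.\<close>
    have E: "expectation (\<lambda>w. ?I n l u (X i w) * indicator {1} (Y i j w))
        = (\<integral>x. ?I n l u x * \<sigma>_star j (u_star \<bullet> x) \<partial>Q)" if i: "i \<ge> 1" for n l u i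
      using expectation_indicator_label[OF X_meas[OF i] Y_meas[OF i j] I_meas'[of n l u] _ h] Y_cond_prob[OF i j, of 1]
        X_ident[OF i] by (simp add: Q_def indicator_def)
    show "AE w in M. \<forall>\<^sub>F n in sequentially. \<forall>l\<in>{..2 * n\<^sup>2}. ?DB n j l w \<le> r n"
      using dev[of "\<lambda>n l u z. ?I n l u (fst z) * indicator {1} (snd z j)"
          "\<lambda>n l u. \<integral>x. ?I n l u x * \<sigma>_star j (u_star \<bullet> x) \<partial>Q", OF m1 b] E j
      by (simp add: obs_def)
  qed
  \<comment> \<open>One function for each \<open>n\<close>, put into the same template as a family
    that is constant in \<open>l\<close>.\<close>
  have devh: "AE w in M. \<forall>\<^sub>F n in sequentially. \<forall>l\<in>{..2 * n\<^sup>2}.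
      \<bar>(\<Sum>i=1..n. min 1 (L\<^sup>2 * ((u_init n w - u_star) \<bullet> X i w)\<^sup>2)) / real n
        - (\<integral>x. min 1 (L\<^sup>2 * ((u_init n w - u_star) \<bullet> x)\<^sup>2) \<partial>Q)\<bar> \<le> r n"
  proof -
    have m1: "(\<lambda>(u, z). min 1 (L\<^sup>2 * ((u - u_star) \<bullet> fst z)\<^sup>2)) \<in> borel_measurable (borel \<Otimes>\<^sub>M obs_space m)"
      by measurable
    have m2: "(\<lambda>x. min 1 (L\<^sup>2 * ((u - u_star) \<bullet> x)\<^sup>2)) \<in> borel_measurable borel" for u
      by measurable
    have b: "min 1 (L\<^sup>2 * ((u - u_star) \<bullet> fst z)\<^sup>2) \<in> {0..1}" for u and z :: "(real^'d) \<times> (nat \<Rightarrow> real)"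
      by auto
    show ?thesis
      using dev[of "\<lambda>n l u z. min 1 (L\<^sup>2 * ((u - u_star) \<bullet> fst z)\<^sup>2)"
          "\<lambda>n l u. \<integral>x. min 1 (L\<^sup>2 * ((u - u_star) \<bullet> x)\<^sup>2) \<partial>Q", OF m1 b] EX[OF _ m2]
      by (simp add: obs_def)
  qed
  \<comment> \<open>The summand 1 serves the case of a large initial error, the quotient by
    \<open>L\<close> matches the factor \<open>L\<close> in the last term of the rate, and
    \<open>16 * (L\<^sup>2 * V)\<close> goes with the squared initial error.\<close>
  define C where "C = real m * (1 + (40 * (3 + 4 * L + 8 * V) + 8) / L + 16 * (L\<^sup>2 * V))"
  have V: "V \<ge> 0" unfolding V_def by simp
  have C1: "real m \<le> C"
  proof -
    have "0 \<le> (40 * (3 + 4 * L + 8 * V) + 8) / L" "0 \<le> 16 * (L\<^sup>2 * V)"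
      using L V by (auto intro!: divide_nonneg_nonneg)
    then have "1 \<le> 1 + (40 * (3 + 4 * L + 8 * V) + 8) / L + 16 * (L\<^sup>2 * V)"
      by linarith
    from mult_left_mono[OF this, of "real m"] show ?thesis by (simp add: C_def)
  qed
  show ?thesis
    using dev1 devW devB devh u_init_err \<sigma>_hat
  proof eventually_elim
    case (elim w)
    let ?rhs = "\<lambda>n. real n powr (2 / (3 * k) - 2 / 3) + (eps n w)\<^sup>2 + L * real n powr (- (k / (2 * (k + 1))))"
    have evW: "\<forall>\<^sub>F n in sequentially. \<forall>j\<in>{1..m}. \<forall>l\<in>{..2 * n\<^sup>2}. ?DW n j l w \<le> r n"
      using elim(2) by (intro eventually_ball_finite) auto
    have evB: "\<forall>\<^sub>F n in sequentially. \<forall>j\<in>{1..m}. \<forall>l\<in>{..2 * n\<^sup>2}. ?DB n j l w \<le> r n"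
      using elim(3) by (intro eventually_ball_finite) auto
    show ?case
    proof (rule exI[of _ C])
      show "\<forall>\<^sub>F n in sequentially.
           link_L2_sq (distr M (obs_space m) (obs m X Y 1)) m u_star (\<sigma>_hat n w) \<sigma>_star \<le> C * ?rhs n"
        using elim(1) evW evB elim(4) eventually_ge_at_top[of 1]
      proof eventually_elim
        case (elim n)
        have n: "n \<ge> 1" by fact
        let ?u = "u_init n w" and ?\<sigma> = "\<sigma>_hat n w"
        define \<delta> where "\<delta> = norm (?u - u_star)"
        have \<delta>: "0 \<le> \<delta>" "\<delta> \<le> eps n w" using \<open>\<forall>n\<ge>1. norm (u_init n w - u_star) \<le> eps n w\<close> n by (simp_all add: \<delta>_def)
        then have \<delta>2: "\<delta>\<^sup>2 \<le> (eps n w)\<^sup>2" by (intro power_mono)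
        have arg: "?\<sigma> \<in> Fsp" "emp_loss n m ?u (\<lambda>i. X i w) (\<lambda>i j. Y i j w) ?\<sigma>
            \<le> emp_loss n m ?u (\<lambda>i. X i w) (\<lambda>i j. Y i j w) \<sigma>_star"
          using \<open>\<forall>n\<ge>1. is_arg_min _ _ _\<close> n \<sigma>_star by (auto simp: is_arg_min_def not_less)
        have ss: "?\<sigma> j \<in> link_class L" if "j \<in> {1..m}" for j
          using Fsp arg(1) that by (auto simp: PiE_iff)
        have obs1: "obs m X Y 1 \<in> measurable M (obs_space m)"
          using obs_indep by (auto simp: indep_vars_def)
        have L2: "link_L2_sq (distr M (obs_space m) (obs m X Y 1)) m u_star ?\<sigma> \<sigma>_star
            = (\<Sum>j=1..m. \<integral>x. (?\<sigma> j (u_star \<bullet> x) - \<sigma>_star j (u_star \<bullet> x))\<^sup>2 \<partial>Q)"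
          unfolding Q_def
          by (rule link_L2_sq_eq[OF M X_meas Y_meas obs1 ss gs]) simp_all
        \<comment> \<open>Discretisation and tail errors, of order \<open>1 / n\<close> and
          \<open>1 / n^2\<close>, are absorbed into \<open>r n\<close> because
          \<open>a < 1\<close>.\<close>
        have rn: "0 \<le> r n" "1 / real n \<le> r n" "1 / (real n)\<^sup>2 \<le> r n"
        proof -
          show "0 \<le> r n" by (simp add: r_def)
          have "real n powr - 1 \<le> r n" unfolding r_def using a n by (intro powr_mono) auto
          then show 1: "1 / real n \<le> r n" using n by (simp add: powr_minus_divide)
          have "1 / (real n)\<^sup>2 \<le> 1 / real n" using n by (simp add: field_simps power2_eq_square)
          with 1 show "1 / (real n)\<^sup>2 \<le> r n" by linarith
        qed
        \<comment> \<open>The last term of the rate is exactly \<open>L * r n\<close>; the first one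
          is nonnegative and is dropped.\<close>
        have rhs: "(eps n w)\<^sup>2 + L * r n \<le> ?rhs n" by (simp add: r_def a_def)
        show ?case
        \<comment> \<open>If \<open>\<delta> \<ge> 1\<close>, the loss is at most \<open>m\<close>
          while the rate is at least 1. Otherwise the triangle inequality gives
          \<open>norm ?u \<le> 2\<close>, and the excess risk bound applies.\<close>
        proof (cases "\<delta> \<ge> 1")
          case True
          interpret Q: prob_space Q by (rule Q(1))
          have "(\<integral>x. (?\<sigma> j (u_star \<bullet> x) - \<sigma>_star j (u_star \<bullet> x))\<^sup>2 \<partial>Q) \<le> 1" if j: "j \<in> {1..m}" for j
          proof (rule Q.integral_le_const)
            have le: "(?\<sigma> j t - \<sigma>_star j t)\<^sup>2 \<le> 1" for t
              using link_classD(4,5)[OF ss[OF j], of t] gl(4,5)[OF j, of t] by (simp add: abs_square_le_1 abs_le_iff)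
            then show "AE x in Q. (?\<sigma> j (u_star \<bullet> x) - \<sigma>_star j (u_star \<bullet> x))\<^sup>2 \<le> 1" by simp
            show "integrable Q (\<lambda>x. (?\<sigma> j (u_star \<bullet> x) - \<sigma>_star j (u_star \<bullet> x))\<^sup>2)"
              using link_classD(7)[OF ss[OF j]] gl(7)[OF j] le
              by (intro Q.integrable_const_bound[where B = 1]) (auto simp: Q_def)
          qed
          then have "link_L2_sq (distr M (obs_space m) (obs m X Y 1)) m u_star ?\<sigma> \<sigma>_star \<le> real m"
            unfolding L2 using sum_bounded_above[of "{1..m}" _ "1::real"] by simp
          also have "\<dots> \<le> C * 1" using C1 by simp
          also have "\<dots> \<le> C * ?rhs n"
          proof (rule mult_left_mono)
            have "1 \<le> \<delta>\<^sup>2" using True by simp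
            then show "1 \<le> ?rhs n" using \<delta>2 rhs mult_nonneg_nonneg[OF less_imp_le[OF L] rn(1)] by linarith
          qed (use C1 in linarith)
          finally show ?thesis .
        next
          case False
          let ?q = "3 * r n + 4 * L / real n + 8 * V / (real n)\<^sup>2"
          have u2: "norm ?u \<le> 2"
            using norm_triangle_sub[of ?u u_star] u_star False by (simp add: \<delta>_def)
          have "link_L2_sq (distr M (obs_space m) (obs m X Y 1)) m u_star ?\<sigma> \<sigma>_star
              \<le> real m * (40 * ?q + 8 * r n + 16 * (L\<^sup>2 * \<delta>\<^sup>2 * V))"
            unfolding L2 \<delta>_def V_def
          proof (rule erm_excess_le[OF Q Q_sq n u2 ss gs, where x = "\<lambda>i. X i w" and b = "\<lambda>i j. indicator {1} (Y i j w)"])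
            show "(\<Sum>i=1..n. \<Sum>j=1..m. (?\<sigma> j (?u \<bullet> X i w) - indicator {1} (Y i j w))\<^sup>2)
              \<le> (\<Sum>i=1..n. \<Sum>j=1..m. (\<sigma>_star j (?u \<bullet> X i w) - indicator {1} (Y i j w))\<^sup>2)"
              using arg(2) by (simp add: emp_loss_def)
          qed (use elim in \<open>auto simp: indicator_def\<close>)
          also have "\<dots> \<le> real m * ((40 * (3 + 4 * L + 8 * V) + 8) * r n + 16 * (L\<^sup>2 * V) * (eps n w)\<^sup>2)"
          proof (rule mult_left_mono)
            have "L * (1 / real n) \<le> L * r n" "V * (1 / (real n)\<^sup>2) \<le> V * r n"
              "L\<^sup>2 * V * \<delta>\<^sup>2 \<le> L\<^sup>2 * V * (eps n w)\<^sup>2"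
              by (rule mult_left_mono; use L V rn \<delta>2 in simp)+
            moreover have "40 * ?q + 8 * r n + 16 * (L\<^sup>2 * \<delta>\<^sup>2 * V)
                = 128 * r n + 160 * (L * (1 / real n)) + 320 * (V * (1 / (real n)\<^sup>2)) + 16 * (L\<^sup>2 * V * \<delta>\<^sup>2)"
              by (simp add: algebra_simps)
            moreover have "(40 * (3 + 4 * L + 8 * V) + 8) * r n + 16 * (L\<^sup>2 * V) * (eps n w)\<^sup>2
                = 128 * r n + 160 * (L * r n) + 320 * (V * r n) + 16 * (L\<^sup>2 * V * (eps n w)\<^sup>2)"
              by (simp add: algebra_simps)
            ultimately show "40 * ?q + 8 * r n + 16 * (L\<^sup>2 * \<delta>\<^sup>2 * V)
              \<le> (40 * (3 + 4 * L + 8 * V) + 8) * r n + 16 * (L\<^sup>2 * V) * (eps n w)\<^sup>2"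
              by linarith
          qed simp
          also have "\<dots> \<le> C * ((eps n w)\<^sup>2 + L * r n)"
          proof -
            let ?K = "40 * (3 + 4 * L + 8 * V) + 8"
            \<comment> \<open>Multiplying out \<open>C\<close> leaves the wanted bound plus cross
              terms, all of which are nonnegative.\<close>
            have "C * ((eps n w)\<^sup>2 + L * r n) = real m * (?K * r n + 16 * (L\<^sup>2 * V) * (eps n w)\<^sup>2)
                + real m * ((1 + ?K / L) * (eps n w)\<^sup>2 + (1 + 16 * (L\<^sup>2 * V)) * (L * r n))"
              using L by (simp add: C_def field_simps)
            moreover have "0 \<le> real m * ((1 + ?K / L) * (eps n w)\<^sup>2 + (1 + 16 * (L\<^sup>2 * V)) * (L * r n))"
              using L V rn(1) by (intro mult_nonneg_nonneg add_nonneg_nonneg) auto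
            ultimately show ?thesis by linarith
          qed
          also have "\<dots> \<le> C * ?rhs n"
            using rhs C1 by (intro mult_left_mono) auto
          finally show ?thesis .
        qed
      qed
    qed
  qed
qed

end
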